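(* Let $\mathcal V$ be a variety of finite signature such that $\mathcal V_{f.g.}$ has the ascending chain condition and the isomorphism problem for finite presentations in $\mathcal V$ is decidable. Then for every $n\ge1$, $\cong_{\mathcal V_n}\ <_c\ \cong_{\mathcal V_{n+1}}$.
   Context: $W_e$ denotes the $e$-th c.e. set and $\langle\cdot,\cdot\rangle$ a computable pairing function. A variety is the class of algebras in a fixed algebraic signature satisfying a fixed c.e. set of equational laws. For $k\ge1$, $X_k=\{x_0,\dots,x_{k-1}\}$; fix a computable bijective coding of pairs of terms over $X_k$ by natural numbers, and let $\langle X_k\mid R\rangle_{\mathcal V}$ be $\mathcal T(X_k)$ modulo the smallest congruence containing $R$ and all instances of the laws of $\mathcal V$. $\mathcal V_n[e]=\langle X_n\mid W_e\rangle_{\mathcal V}$ and $e\cong_{\mathcal V_n}i$ iff $\mathcal V_n[e]\cong\mathcal V_n[i]$; $\mathcal V_{f.g.}$ is the class of all $\langle X_k\mid W_e\rangle_{\mathcal V}$, $k\ge1$. ACC: every ascending chain of congruences of every algebra in $\mathcal V_{f.g.}$ is eventually constant. The isomorphism problem for finite presentations is decidable if there is an algorithm deciding, for finite $k,j$ and finite sets $R,S$ of pairs of terms, whether $\langle X_k\mid R\rangle_{\mathcal V}\cong\langle X_j\mid S\rangle_{\mathcal V}$. $E\le_c F$ means there is a total computable $h$ with $x\,E\,y\iff h(x)\,F\,h(y)$; $E<_c F$ means $E\le_c F$ and not $F\le_c E$.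
   Formalization: The formal theorem also assumes that the variety is nontrivial (some algebra in V_f.g. has at least two elements); for the trivial variety satisfying x = y all the isomorphism relations are total, so the strict reducibility fails. *)

theory Defs
  imports Main "HOL-Library.Nat_Bijection"
begin

section \<open>Computability\<close>

text \<open>
  Unary partial recursive functions; several arguments are passed through the Cantor pairing
  function \<^const>\<open>prod_encode\<close>.
\<close>

datatype prog =
    Zero | Succ | Left | Right
  | Split prog prog
  | Comp prog prog
  | PrimRec prog prog
  | Minim prog

primrec run :: "prog \<Rightarrow> nat \<Rightarrow> nat option" where
  "run Zero x = Some 0"
| "run Succ x = Some (Suc x)"
| "run Left x = Some (fst (prod_decode x))"
| "run Right x = Some (snd (prod_decode x))"
| "run (Split p q) x =
     Option.bind (run p x) (\<lambda>u. Option.bind (run q x) (\<lambda>v. Some (prod_encode (u, v))))"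
| "run (Comp p q) x = Option.bind (run q x) (run p)"
| "run (PrimRec p q) x =
     (let (a, n) = prod_decode x in
      rec_nat (run p a)
        (\<lambda>m r. Option.bind r (\<lambda>v. run q (prod_encode (a, prod_encode (m, v))))) n)"
| "run (Minim p) x =
     (if \<exists>n. run p (prod_encode (x, n)) = Some 0 \<and>
             (\<forall>m<n. \<exists>v. run p (prod_encode (x, m)) = Some (Suc v))
      then Some (LEAST n. run p (prod_encode (x, n)) = Some 0)
      else None)"

lemma fst_prod_decode_le: "fst (prod_decode x) \<le> x"
  by (metis le_prod_encode_1 prod.collapse prod_decode_inverse)

lemma snd_prod_decode_le: "snd (prod_decode x) \<le> x"
  by (metis le_prod_encode_2 prod.collapse prod_decode_inverse)

function prog_of :: "nat \<Rightarrow> prog" where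
  "prog_of n =
     (if n = 0 then Zero else if n = 1 then Succ else if n = 2 then Left else if n = 3 then Right
      else
        let r = (n - 4) mod 4; m = (n - 4) div 4; a = fst (prod_decode m); b = snd (prod_decode m)
        in if r = 0 then Split (prog_of a) (prog_of b)
           else if r = 1 then Comp (prog_of a) (prog_of b)
           else if r = 2 then PrimRec (prog_of a) (prog_of b)
           else Minim (prog_of m))"
  by auto
termination
proof -
  have *: "(n - 4) div 4 < n" "fst (prod_decode ((n - 4) div 4)) < n"
    "snd (prod_decode ((n - 4) div 4)) < n" if "n \<noteq> 0" for n :: nat
  proof -
    have "(n - 4) div 4 \<le> n - 4"
      by simp
    with that show lt: "(n - 4) div 4 < n"
      by linarith
    show "fst (prod_decode ((n - 4) div 4)) < n"
      using fst_prod_decode_le lt by (rule le_less_trans)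
    show "snd (prod_decode ((n - 4) div 4)) < n"
      using snd_prod_decode_le lt by (rule le_less_trans)
  qed
  show ?thesis
    by (relation "measure id") (use * in \<open>simp_all del: One_nat_def\<close>)
qed

declare prog_of.simps [simp del]

lemma surj_prog_of: "surj prog_of"
proof -
  have step: "\<exists>n. prog_of n = (if r = 0 then Split (prog_of a) (prog_of b)
           else if r = 1 then Comp (prog_of a) (prog_of b)
           else if r = 2 then PrimRec (prog_of a) (prog_of b)
           else Minim (prog_of (prod_encode (a, b))))" if "r < 4" for r a b :: nat
    by (rule exI [of _ "4 + (4 * prod_encode (a, b) + r)"], subst prog_of.simps)
      (use that in \<open>simp add: Let_def\<close>)
  have "\<exists>n. prog_of n = p" for p
  proof (induction p)
    case Zero
    have "prog_of 0 = Zero" by (simp add: prog_of.simps)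
    then show ?case ..
  next
    case Succ
    have "prog_of 1 = Succ" by (simp add: prog_of.simps)
    then show ?case ..
  next
    case Left
    have "prog_of 2 = Left" by (simp add: prog_of.simps)
    then show ?case ..
  next
    case Right
    have "prog_of 3 = Right" by (simp add: prog_of.simps)
    then show ?case ..
  next
    case (Split p q)
    then obtain a b where "prog_of a = p" "prog_of b = q" by blast
    then show ?case using step [of 0 a b] by simp
  next
    case (Comp p q)
    then obtain a b where "prog_of a = p" "prog_of b = q" by blast
    then show ?case using step [of 1 a b] by simp
  next
    case (PrimRec p q)
    then obtain a b where "prog_of a = p" "prog_of b = q" by blast
    then show ?case using step [of 2 a b] by simp
  next
    case (Minim p)
    then obtain m where "prog_of m = p" by blast
    then show ?case
      using step [of 3 "fst (prod_decode m)" "snd (prod_decode m)"] by simp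
  qed
  then show ?thesis by (metis surjI)
qed

definition W :: "nat \<Rightarrow> nat set" where
  "W e = dom (run (prog_of e))"

definition computable :: "(nat \<Rightarrow> nat) \<Rightarrow> bool" where
  "computable h \<longleftrightarrow> (\<exists>p. \<forall>x. run p x = Some (h x))"

definition reducible :: "(nat \<Rightarrow> nat \<Rightarrow> bool) \<Rightarrow> (nat \<Rightarrow> nat \<Rightarrow> bool) \<Rightarrow> bool" (infix "\<le>\<^sub>c" 50) where
  "E \<le>\<^sub>c F \<longleftrightarrow> (\<exists>h. computable h \<and> (\<forall>x y. E x y \<longleftrightarrow> F (h x) (h y)))"

definition strictly_reducible :: "(nat \<Rightarrow> nat \<Rightarrow> bool) \<Rightarrow> (nat \<Rightarrow> nat \<Rightarrow> bool) \<Rightarrow> bool"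
    (infix "<\<^sub>c" 50) where
  "E <\<^sub>c F \<longleftrightarrow> E \<le>\<^sub>c F \<and> \<not> F \<le>\<^sub>c E"


section \<open>Algebras\<close>

text \<open>
  A finite signature is the list of arities of its operation symbols, which are the numbers
  below the length of the list.
\<close>

record 'a algebra =
  carrier :: "'a set"
  op :: "nat \<Rightarrow> 'a list \<Rightarrow> 'a"

definition congruence :: "nat list \<Rightarrow> 'a algebra \<Rightarrow> ('a \<times> 'a) set \<Rightarrow> bool" where
  "congruence ar A \<theta> \<longleftrightarrow>
     equiv (carrier A) \<theta> \<and>
     (\<forall>f<length ar. \<forall>as bs. length as = ar ! f \<longrightarrow> list_all2 (\<lambda>a b. (a, b) \<in> \<theta>) as bs \<longrightarrow>
        (op A f as, op A f bs) \<in> \<theta>)"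

definition quotient_algebra :: "'a algebra \<Rightarrow> ('a \<times> 'a) set \<Rightarrow> 'a set algebra" where
  "quotient_algebra A \<theta> =
     \<lparr>carrier = carrier A // \<theta>, op = (\<lambda>f Cs. \<theta> `` (op A f ` listset Cs))\<rparr>"

definition isomorphic :: "nat list \<Rightarrow> 'a algebra \<Rightarrow> 'b algebra \<Rightarrow> bool" where
  "isomorphic ar A B \<longleftrightarrow>
     (\<exists>\<phi>. bij_betw \<phi> (carrier A) (carrier B) \<and>
        (\<forall>f<length ar. \<forall>as. length as = ar ! f \<longrightarrow> set as \<subseteq> carrier A \<longrightarrow>
           \<phi> (op A f as) = op B f (map \<phi> as)))"


section \<open>Terms and presentations\<close>

datatype trm = Var nat | Fun nat "trm list"

inductive_set terms :: "nat list \<Rightarrow> nat set \<Rightarrow> trm set" for ar :: "nat list" and X :: "nat set" where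
  var: "i \<in> X \<Longrightarrow> Var i \<in> terms ar X"
| app: "f < length ar \<Longrightarrow> length ts = ar ! f \<Longrightarrow> (\<And>t. t \<in> set ts \<Longrightarrow> t \<in> terms ar X)
          \<Longrightarrow> Fun f ts \<in> terms ar X"

primrec subst :: "(nat \<Rightarrow> trm) \<Rightarrow> trm \<Rightarrow> trm" where
  "subst \<sigma> (Var i) = \<sigma> i"
| "subst \<sigma> (Fun f ts) = Fun f (map (subst \<sigma>) ts)"

definition term_algebra :: "nat list \<Rightarrow> nat \<Rightarrow> trm algebra" where
  "term_algebra ar k = \<lparr>carrier = terms ar {..<k}, op = Fun\<rparr>"

definition law_instances :: "nat list \<Rightarrow> (trm \<times> trm) set \<Rightarrow> nat \<Rightarrow> (trm \<times> trm) set" where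
  "law_instances ar L k =
     {(subst \<sigma> s, subst \<sigma> t) | s t \<sigma>. (s, t) \<in> L \<and> range \<sigma> \<subseteq> terms ar {..<k}}"

definition presented :: "nat list \<Rightarrow> (trm \<times> trm) set \<Rightarrow> nat \<Rightarrow> (trm \<times> trm) set \<Rightarrow> trm set algebra" where
  "presented ar L k R =
     quotient_algebra (term_algebra ar k)
       (\<Inter>{\<theta>. congruence ar (term_algebra ar k) \<theta> \<and> R \<union> law_instances ar L k \<subseteq> \<theta>})"


section \<open>Coding of terms\<close>

primrec tuple_of :: "nat \<Rightarrow> nat \<Rightarrow> nat list" where
  "tuple_of 0 x = []"
| "tuple_of (Suc a) x =
     (if a = 0 then [x] else fst (prod_decode x) # tuple_of a (snd (prod_decode x)))"

lemma tuple_of_le: "y \<in> set (tuple_of a x) \<Longrightarrow> y \<le> x"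
proof (induction a arbitrary: x)
  case (Suc a)
  then show ?case
    by (auto split: if_splits intro: fst_prod_decode_le order_trans [OF _ snd_prod_decode_le])
qed simp

definition atoms :: "nat list \<Rightarrow> nat \<Rightarrow> trm list" where
  "atoms ar k = map Var [0..<k] @ map (\<lambda>f. Fun f []) (filter (\<lambda>f. ar ! f = 0) [0..<length ar])"

definition proper_symbols :: "nat list \<Rightarrow> nat list" where
  "proper_symbols ar = filter (\<lambda>f. ar ! f \<noteq> 0) [0..<length ar]"

text \<open>
  The \<open>n\<close>-th term over \<open>x\<^sub>0, \<dots>, x\<^bsub>k-1\<^esub>\<close>, for \<open>k \<ge> 1\<close>.  This is a bijection unless all
  symbols are constants.  In that case there are only finitely many terms, so no bijective coding
  by all natural numbers exists, and the numbering below is merely surjective.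
\<close>

function term_of :: "nat list \<Rightarrow> nat \<Rightarrow> nat \<Rightarrow> trm" where
  "term_of ar k n =
     (let q = length (atoms ar k); p = length (proper_symbols ar) in
      if n < q \<or> q = 0 \<or> p = 0 then atoms ar k ! (n mod q)
      else
        let f = proper_symbols ar ! ((n - q) mod p)
        in Fun f (map (term_of ar k) (tuple_of (ar ! f) ((n - q) div p))))"
  by auto
termination
proof (relation "measure (\<lambda>(ar, k, n). n)", simp, clarsimp)
  fix ar k n f y
  assume y: "y \<in> set (tuple_of f ((n - length (atoms ar k)) div length (proper_symbols ar)))"
    and "\<not> n < length (atoms ar k)" "atoms ar k \<noteq> []"
  then have "n - length (atoms ar k) < n"
    by (metis diff_less length_greater_0_conv not_less order_less_le_trans)
  then show "y < n"
    using tuple_of_le [OF y] div_le_dividend le_trans le_less_trans by metis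
qed

declare term_of.simps [simp del]

definition pair_of :: "nat list \<Rightarrow> nat \<Rightarrow> nat \<Rightarrow> trm \<times> trm" where
  "pair_of ar k c = map_prod (term_of ar k) (term_of ar k) (prod_decode c)"

lemma bij_tuple_of:
  assumes "a > 0"
  shows "bij_betw (tuple_of a) UNIV {xs. length xs = a}"
  using assms
proof (induction a)
  case (Suc a)
  show ?case
  proof (cases "a = 0")
    case True
    then show ?thesis
      by (auto simp: bij_betw_def inj_on_def length_Suc_conv)
  next
    case False
    then have IH: "inj (tuple_of a)" "range (tuple_of a) = {xs. length xs = a}"
      using Suc by (auto simp: bij_betw_def)
    have "inj (tuple_of (Suc a))"
      using False by (auto simp: inj_on_def prod_eq_iff
          dest!: injD [OF IH(1)] intro!: injD [OF inj_prod_decode])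
    moreover have "xs \<in> range (tuple_of (Suc a))" if len: "length xs = Suc a" for xs
    proof -
      obtain y ys where xs: "xs = y # ys" "length ys = a"
        using len by (auto simp: length_Suc_conv)
      then obtain z where "ys = tuple_of a z"
        using IH(2) by blast
      then have "xs = tuple_of (Suc a) (prod_encode (y, z))"
        using False xs by simp
      then show ?thesis by blast
    qed
    moreover have "length (tuple_of b x) = b" for b x
      by (induction b arbitrary: x) auto
    ultimately show ?thesis
      unfolding bij_betw_def by (auto simp del: tuple_of.simps)
  qed
qed simp

lemma term_of_atom:
  "n < length (atoms ar k) \<Longrightarrow> term_of ar k n = atoms ar k ! n"
  by (subst term_of.simps) (simp add: Let_def)

lemma term_of_app:
  assumes "j < length (proper_symbols ar)" "atoms ar k \<noteq> []"
  shows "term_of ar k (length (atoms ar k) + (j + length (proper_symbols ar) * z)) =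
    Fun (proper_symbols ar ! j) (map (term_of ar k) (tuple_of (ar ! (proper_symbols ar ! j)) z))"
  using assms by (subst term_of.simps) (auto simp: Let_def)

lemma atoms_in_terms: "t \<in> set (atoms ar k) \<Longrightarrow> t \<in> terms ar {..<k}"
  by (auto simp: atoms_def intro: terms.intros)

lemma proper_symbols_iff: "f \<in> set (proper_symbols ar) \<longleftrightarrow> f < length ar \<and> ar ! f \<noteq> 0"
  by (auto simp: proper_symbols_def)

lemma length_tuple_of: "length (tuple_of a x) = a"
  by (induction a arbitrary: x) auto

lemma code_cases:
  obtains (atom) "n < length (atoms ar k)"
  | (wrap) "proper_symbols ar = []"
  | (app) j z where "j < length (proper_symbols ar)"
      "n = length (atoms ar k) + (j + length (proper_symbols ar) * z)"
proof -
  define p q where "p = length (proper_symbols ar)" and "q = length (atoms ar k)"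
  consider "n < q" | "p = 0" | "n \<ge> q" "p > 0"
    by linarith
  then show thesis
  proof cases
    case 3
    then have "(n - q) mod p < p" "n = q + ((n - q) mod p + p * ((n - q) div p))"
      by simp_all
    then show thesis
      using that(3) unfolding p_def q_def by blast
  qed (use that(1,2) in \<open>auto simp: p_def q_def\<close>)
qed

lemma range_term_of:
  assumes k: "k \<ge> 1"
  shows "range (term_of ar k) = terms ar {..<k}"
proof -
  have ne: "atoms ar k \<noteq> []"
    using k by (auto simp: atoms_def)
  have "term_of ar k n \<in> terms ar {..<k}" for n
  proof (induction n rule: less_induct)
    case (less n)
    show ?case
    proof (cases rule: code_cases [where n = n and ar = ar and k = k])
      case atom
      then show ?thesis
        by (auto simp: term_of_atom intro: atoms_in_terms)
    next
      case wrap
      then have "term_of ar k n = atoms ar k ! (n mod length (atoms ar k))"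
        by (subst term_of.simps) (simp add: Let_def)
      then show ?thesis
        using ne by (auto intro: atoms_in_terms)
    next
      case (app j z)
      let ?f = "proper_symbols ar ! j"
      have f: "?f < length ar" "ar ! ?f \<noteq> 0"
        using app(1) proper_symbols_iff nth_mem by blast+
      have "z \<le> length (proper_symbols ar) * z"
        using app(1) by (cases "length (proper_symbols ar)") auto
      moreover have "length (atoms ar k) > 0"
        using ne by simp
      ultimately have "z < n"
        using app(2) by linarith
      then have "term_of ar k y \<in> terms ar {..<k}" if "y \<in> set (tuple_of (ar ! ?f) z)" for y
        using less tuple_of_le [OF that] by simp
      then show ?thesis
        unfolding app(2) term_of_app [OF app(1) ne]
        by (intro terms.app) (use f in \<open>auto simp: length_tuple_of\<close>)
    qed
  qed
  moreover have "\<exists>n. term_of ar k n = t" if "t \<in> terms ar {..<k}" for t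
    using that
  proof induction
    case (var i)
    then show ?case
      by (intro exI [of _ i]) (simp add: term_of_atom atoms_def nth_append)
  next
    case (app f ts)
    show ?case
    proof (cases "ar ! f = 0")
      case True
      with app have "Fun f ts \<in> set (atoms ar k)"
        by (auto simp: atoms_def)
      then show ?thesis
        by (metis in_set_conv_nth term_of_atom)
    next
      case False
      have "\<exists>ns. ts = map (term_of ar k) ns"
        unfolding ex_map_conv using app(4) by (simp add: eq_commute)
      then obtain ns where ns: "ts = map (term_of ar k) ns" ..
      then have "length ns = ar ! f"
        using app(2) by auto
      then obtain z where z: "ns = tuple_of (ar ! f) z"
        using bij_tuple_of [of "ar ! f"] False by (auto simp: bij_betw_def)
      obtain j where "j < length (proper_symbols ar)" "proper_symbols ar ! j = f"
        using app(1) False by (metis in_set_conv_nth proper_symbols_iff)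
      then show ?thesis
        using term_of_app [OF _ ne, of j z] z ns by auto
    qed
  qed
  ultimately show ?thesis
    by (auto simp: image_iff) metis
qed

lemma bij_term_of:
  assumes k: "k \<ge> 1" and proper: "proper_symbols ar \<noteq> []"
  shows "bij_betw (term_of ar k) UNIV (terms ar {..<k})"
proof -
  have ne: "atoms ar k \<noteq> []"
    using k by (auto simp: atoms_def)
  have dist: "distinct (atoms ar k)" "distinct (proper_symbols ar)"
    by (auto simp: atoms_def proper_symbols_def distinct_map inj_on_def)
  have atom_neq: "atoms ar k ! i \<noteq> Fun (proper_symbols ar ! j) ts"
    if "i < length (atoms ar k)" "j < length (proper_symbols ar)" for i j ts
  proof
    assume "atoms ar k ! i = Fun (proper_symbols ar ! j) ts"
    then have "Fun (proper_symbols ar ! j) ts \<in> set (atoms ar k)"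
      using that by (metis nth_mem)
    then show False
      using proper_symbols_iff [of "proper_symbols ar ! j" ar] that by (auto simp: atoms_def)
  qed
  have "n = m" if "term_of ar k n = term_of ar k m" for n m
    using that
  proof (induction n arbitrary: m rule: less_induct)
    case (less n)
    show ?case
    proof (cases rule: code_cases [where n = n and ar = ar and k = k])
      case atom
      show ?thesis
      proof (cases rule: code_cases [where n = m and ar = ar and k = k])
        case m: atom
        then show ?thesis
          using less(2) atom dist by (simp add: term_of_atom nth_eq_iff_index_eq)
      next
        case m: (app j z)
        then show ?thesis
          using less(2) atom atom_neq [of n j] term_of_app [OF m(1) ne] by (simp add: term_of_atom)
      qed (use proper in auto)
    next
      case n: (app j z)
      show ?thesis
      proof (cases rule: code_cases [where n = m and ar = ar and k = k])
        case atom
        then show ?thesis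
          using less(2) atom_neq [OF _ n(1)] unfolding n(2) term_of_app [OF n(1) ne]
          by (simp add: term_of_atom) metis
      next
        case m: (app j' z')
        let ?f = "proper_symbols ar ! j"
        have "?f = proper_symbols ar ! j'"
          and args: "map (term_of ar k) (tuple_of (ar ! ?f) z) =
            map (term_of ar k) (tuple_of (ar ! ?f) z')"
          using less(2) unfolding n(2) m(2) term_of_app [OF n(1) ne] term_of_app [OF m(1) ne]
          by auto
        then have j: "j = j'"
          using dist n(1) m(1) by (simp add: nth_eq_iff_index_eq)
        have "z \<le> length (proper_symbols ar) * z"
          using n(1) by (cases "length (proper_symbols ar)") auto
        moreover have "length (atoms ar k) > 0"
          using ne by simp
        ultimately have "z < n"
          using n(2) by linarith
        have "tuple_of (ar ! ?f) z = tuple_of (ar ! ?f) z'"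
        proof (rule nth_equalityI)
          fix i
          assume i: "i < length (tuple_of (ar ! ?f) z)"
          then have "tuple_of (ar ! ?f) z ! i < n"
            using tuple_of_le [OF nth_mem] \<open>z < n\<close> by (meson le_less_trans)
          moreover have "term_of ar k (tuple_of (ar ! ?f) z ! i) =
              term_of ar k (tuple_of (ar ! ?f) z' ! i)"
            using arg_cong [OF args, of "\<lambda>us. us ! i"] i by (simp add: length_tuple_of)
          ultimately show "tuple_of (ar ! ?f) z ! i = tuple_of (ar ! ?f) z' ! i"
            by (rule less(1))
        qed (simp add: length_tuple_of)
        moreover have "ar ! ?f > 0"
          using n(1) proper_symbols_iff nth_mem by blast
        ultimately have "z = z'"
          using bij_tuple_of by (auto simp: bij_betw_def dest: injD)
        then show ?thesis
          using j n(2) m(2) by simp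
      qed (use proper in auto)
    qed (use proper in auto)
  qed
  then show ?thesis
    using range_term_of [OF k] by (auto simp: bij_betw_def inj_def)
qed


section \<open>Varieties\<close>

text \<open>
  A variety is given by its signature \<open>ar\<close> and its set \<open>L\<close> of laws.  Every law involves finitely
  many variables, hence occurs in the coding of pairs over \<open>x\<^sub>0, \<dots>, x\<^bsub>k-1\<^esub>\<close> for some \<open>k\<close>.
\<close>

definition ce_laws :: "nat list \<Rightarrow> (trm \<times> trm) set \<Rightarrow> bool" where
  "ce_laws ar L \<longleftrightarrow>
     L \<subseteq> terms ar UNIV \<times> terms ar UNIV \<and>
     (\<exists>e. W e = {prod_encode (k, c) | k c. k \<ge> 1 \<and> pair_of ar k c \<in> L})"

definition indexed_algebra :: "nat list \<Rightarrow> (trm \<times> trm) set \<Rightarrow> nat \<Rightarrow> nat \<Rightarrow> trm set algebra" where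
  "indexed_algebra ar L n e = presented ar L n (pair_of ar n ` W e)"

definition iso_relation :: "nat list \<Rightarrow> (trm \<times> trm) set \<Rightarrow> nat \<Rightarrow> nat \<Rightarrow> nat \<Rightarrow> bool" where
  "iso_relation ar L n e i \<longleftrightarrow>
     isomorphic ar (indexed_algebra ar L n e) (indexed_algebra ar L n i)"

definition fg_algebras :: "nat list \<Rightarrow> (trm \<times> trm) set \<Rightarrow> trm set algebra set" where
  "fg_algebras ar L = {indexed_algebra ar L k e | k e. k \<ge> 1}"

definition ascending_chain_condition :: "nat list \<Rightarrow> (trm \<times> trm) set \<Rightarrow> bool" where
  "ascending_chain_condition ar L \<longleftrightarrow>
     (\<forall>A\<in>fg_algebras ar L. \<forall>\<theta> :: nat \<Rightarrow> _.
        (\<forall>i. congruence ar A (\<theta> i)) \<longrightarrow> (\<forall>i. \<theta> i \<subseteq> \<theta> (Suc i)) \<longrightarrow>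
        (\<exists>N. \<forall>i\<ge>N. \<theta> i = \<theta> N))"

text \<open>Finite sets of pairs are passed to the algorithm by canonical index (\<^const>\<open>set_decode\<close>).\<close>

definition finite_iso_decidable :: "nat list \<Rightarrow> (trm \<times> trm) set \<Rightarrow> bool" where
  "finite_iso_decidable ar L \<longleftrightarrow>
     (\<exists>d. computable d \<and>
        (\<forall>k\<ge>1. \<forall>j\<ge>1. \<forall>u v.
           d (prod_encode (k, prod_encode (j, prod_encode (u, v)))) =
             (if isomorphic ar (presented ar L k (pair_of ar k ` set_decode u))
                  (presented ar L j (pair_of ar j ` set_decode v))
              then 1 else 0)))"

text \<open>
  Excludes the degenerate variety in which \<open>x \<approx> y\<close> holds.  There all algebras have just one
  element, so that all the relations \<^const>\<open>iso_relation\<close> are total and reducible to each other.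
\<close>

definition nontrivial :: "nat list \<Rightarrow> (trm \<times> trm) set \<Rightarrow> bool" where
  "nontrivial ar L \<longleftrightarrow>
     (\<exists>A\<in>fg_algebras ar L. \<exists>a\<in>carrier A. \<exists>b\<in>carrier A. a \<noteq> b)"

end

theory Submission
  imports Defs
begin

text \<open>
  The ascending chain condition makes all algebras in question finitely presented and Hopfian.
  Identifying \<open>x\<^sub>n\<close> with \<open>x\<^sub>0\<close> turns presentations over \<open>n\<close> generators into presentations over
  \<open>n + 1\<close> generators, whence \<open>\<le>\<^sub>c\<close>.

  Suppose that \<open>h\<close> reduces isomorphism over \<open>n + 1\<close> generators to isomorphism over \<open>n\<close> generators.
  By the recursion theorem there are indices \<open>a\<close> and \<open>b\<close> whose presentations react to the finite
  stages \<open>A s\<close> and \<open>B s\<close> of \<open>W (h a)\<close> and \<open>W (h b)\<close>: the lift of \<open>A s\<close> is put into \<open>W a\<close> as soon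
  as \<open>A s\<close> and \<open>B s\<close> present isomorphic algebras, and into \<open>W b\<close> as soon as, moreover, some later
  stages present non-isomorphic ones.  If the stages are not eventually isomorphic, then
  \<open>W a = W b\<close>, a contradiction.  Otherwise \<open>W a\<close> presents the same algebra as \<open>W (h a)\<close>, while \<open>W b\<close>
  is either empty or the lift of a stage \<open>A m\<close> that is followed by a non-isomorphic stage.  By the
  Hopfian property the algebra of \<open>A m\<close> is isomorphic to that of \<open>W (h a)\<close> only if neither side
  changes after stage \<open>m\<close>; and the free algebra on \<open>n + 1\<close> generators is isomorphic to no
  \<open>n\<close>-generated one, as \<open>x\<^sub>n\<close> and \<open>x\<^sub>0\<close> would be equal in it.
\<close>

section \<open>Computable functions and decidable predicates\<close>

abbreviation pfst :: "nat \<Rightarrow> nat" where "pfst x \<equiv> fst (prod_decode x)"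
abbreviation psnd :: "nat \<Rightarrow> nat" where "psnd x \<equiv> snd (prod_decode x)"

definition decidable :: "(nat \<Rightarrow> bool) \<Rightarrow> bool" where
  "decidable P \<longleftrightarrow> computable (\<lambda>x. of_bool (P x))"

lemma computable_id: "computable (\<lambda>x. x)"
  unfolding computable_def by (rule exI [of _ "Split Left Right"]) simp

lemma computable_compose:
  assumes "computable f" "computable g"
  shows "computable (\<lambda>x. f (g x))"
proof -
  obtain p q where "\<forall>x. run p x = Some (f x)" "\<forall>x. run q x = Some (g x)"
    using assms unfolding computable_def by blast
  then show ?thesis
    unfolding computable_def by (intro exI [of _ "Comp p q"]) simp
qed

lemma computable_Suc: "computable f \<Longrightarrow> computable (\<lambda>x. Suc (f x))"
  by (rule computable_compose [of Suc]) (auto simp: computable_def intro: exI [of _ Succ])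

lemma computable_fst: "computable f \<Longrightarrow> computable (\<lambda>x. pfst (f x))"
  by (rule computable_compose [of pfst]) (auto simp: computable_def intro: exI [of _ Left])

lemma computable_snd: "computable f \<Longrightarrow> computable (\<lambda>x. psnd (f x))"
  by (rule computable_compose [of psnd]) (auto simp: computable_def intro: exI [of _ Right])

lemma computable_const: "computable (\<lambda>x. c)"
proof (induction c)
  case 0
  show ?case
    unfolding computable_def by (rule exI [of _ Zero]) simp
qed (rule computable_Suc)

lemma computable_pair:
  assumes "computable f" "computable g"
  shows "computable (\<lambda>x. prod_encode (f x, g x))"
proof -
  obtain p q where "\<forall>x. run p x = Some (f x)" "\<forall>x. run q x = Some (g x)"
    using assms unfolding computable_def by blast
  then show ?thesis
    unfolding computable_def by (intro exI [of _ "Split p q"]) simp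
qed

lemma computable_rec:
  assumes "computable b" "computable n"
    and "computable (\<lambda>z. g (pfst z) (pfst (psnd z)) (psnd (psnd z)))"
  shows "computable (\<lambda>x. rec_nat (b x) (g x) (n x))"
proof -
  obtain p q r where p: "\<forall>x. run p x = Some (b x)" and q: "\<forall>x. run q x = Some (n x)"
    and r: "\<forall>z. run r z = Some (g (pfst z) (pfst (psnd z)) (psnd (psnd z)))"
    using assms unfolding computable_def by blast
  have "rec_nat (run p x) (\<lambda>m r'. Option.bind r' (\<lambda>v. run r (prod_encode (x, prod_encode (m, v))))) k
      = Some (rec_nat (b x) (g x) k)" for x k
    by (induction k) (simp_all add: p r)
  \<comment> \<open>\<open>Split Left Right\<close> is the identity, so the program first forms the
    pair of the parameter x and the recursion depth n x that \<open>PrimRec\<close> expects.\<close>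
  then have "run (Comp (PrimRec p r) (Split (Split Left Right) q)) x = Some (rec_nat (b x) (g x) (n x))"
    for x
    by (simp add: q)
  then show ?thesis
    unfolding computable_def by blast
qed

section \<open>Arithmetic operations\<close>

lemma computable_pred: "computable f \<Longrightarrow> computable (\<lambda>x. f x - 1)"
proof -
  assume f: "computable f"
  have "f x - 1 = rec_nat 0 (\<lambda>m r. m) (f x)" for x
    by (cases "f x") auto
  moreover have "computable (\<lambda>x. rec_nat 0 (\<lambda>m r. m) (f x))"
    by (intro computable_rec computable_const f computable_fst computable_snd computable_id)
  ultimately show ?thesis by simp
qed

lemma computable_add:
  assumes "computable f" "computable g"
  shows "computable (\<lambda>x. f x + g x)"
proof -
  have "rec_nat a (\<lambda>m r. Suc r) b = a + b" for a b :: nat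
    by (induction b) auto
  moreover have "computable (\<lambda>x. rec_nat (f x) (\<lambda>m r. Suc r) (g x))"
    by (intro computable_rec computable_Suc assms computable_snd computable_id)
  ultimately show ?thesis by simp
qed

lemma computable_diff:
  assumes "computable f" "computable g"
  shows "computable (\<lambda>x. f x - g x)"
proof -
  have "rec_nat a (\<lambda>m r. r - 1) b = a - b" for a b :: nat
    by (induction b) auto
  moreover have "computable (\<lambda>x. rec_nat (f x) (\<lambda>m r. r - 1) (g x))"
    by (intro computable_rec computable_pred assms computable_snd computable_id)
  ultimately show ?thesis by simp
qed

lemma computable_mult:
  assumes "computable f" "computable g"
  shows "computable (\<lambda>x. f x * g x)"
proof -
  have "rec_nat 0 (\<lambda>m r. r + a) b = a * b" for a b :: nat
    by (induction b) auto
  moreover have "computable (\<lambda>x. rec_nat 0 (\<lambda>m r. r + f x) (g x))"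
    by (intro computable_rec computable_const computable_add computable_compose [OF assms(1)] assms
        computable_fst computable_snd computable_id)
  ultimately show ?thesis by simp
qed

lemma computable_power2:
  assumes "computable f"
  shows "computable (\<lambda>x. 2 ^ f x)"
proof -
  have "rec_nat 1 (\<lambda>m r. 2 * r) b = (2 :: nat) ^ b" for b :: nat
    by (induction b) auto
  moreover have "computable (\<lambda>x. rec_nat 1 (\<lambda>m r. 2 * r) (f x))"
    by (intro computable_rec computable_const computable_mult assms computable_snd computable_id)
  ultimately show ?thesis by simp
qed

section \<open>Boolean connectives, comparisons and case distinctions\<close>

lemma computable_of_bool: "decidable P \<Longrightarrow> computable (\<lambda>x. of_bool (P x))"
  by (simp add: decidable_def)

lemma decidable_compose: "decidable P \<Longrightarrow> computable f \<Longrightarrow> decidable (\<lambda>x. P (f x))"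
  unfolding decidable_def by (rule computable_compose)

lemma decidable_const: "decidable (\<lambda>x. c)"
  unfolding decidable_def by (rule computable_const)

lemma decidable_not:
  assumes "decidable P"
  shows "decidable (\<lambda>x. \<not> P x)"
proof -
  have "computable (\<lambda>x. 1 - of_bool (P x))"
    by (intro computable_diff computable_const computable_of_bool assms)
  also have "(\<lambda>x. 1 - of_bool (P x)) = (\<lambda>x. of_bool (\<not> P x) :: nat)"
    by auto
  finally show ?thesis by (simp add: decidable_def)
qed

lemma decidable_conj:
  assumes "decidable P" "decidable Q"
  shows "decidable (\<lambda>x. P x \<and> Q x)"
  using computable_mult [OF assms [THEN computable_of_bool]]
  by (simp add: decidable_def of_bool_conj)

lemma decidable_disj:
  assumes "decidable P" "decidable Q"
  shows "decidable (\<lambda>x. P x \<or> Q x)"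
  using decidable_not [OF decidable_conj [OF assms [THEN decidable_not]]] by simp

lemma computable_if:
  assumes "decidable P" "computable f" "computable g"
  shows "computable (\<lambda>x. if P x then f x else g x)"
proof -
  have "computable (\<lambda>x. of_bool (P x) * f x + of_bool (\<not> P x) * g x)"
    by (intro computable_add computable_mult computable_of_bool decidable_not assms)
  also have "(\<lambda>x. of_bool (P x) * f x + of_bool (\<not> P x) * g x) = (\<lambda>x. if P x then f x else g x)"
    by auto
  finally show ?thesis .
qed

lemma decidable_if:
  assumes "decidable P" "decidable Q" "decidable R"
  shows "decidable (\<lambda>x. if P x then Q x else R x)"
  using computable_if [OF assms(1) assms(2,3) [THEN computable_of_bool]]
  by (simp add: decidable_def if_distrib [of of_bool])

lemma decidable_le:
  assumes "computable f" "computable g"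
  shows "decidable (\<lambda>x. f x \<le> g x)"
proof -
  have "computable (\<lambda>x. 1 - (f x - g x))"
    by (intro computable_diff computable_const assms)
  also have "(\<lambda>x. 1 - (f x - g x)) = (\<lambda>x. of_bool (f x \<le> g x))"
    by auto
  finally show ?thesis by (simp add: decidable_def)
qed

lemma decidable_less:
  assumes "computable f" "computable g"
  shows "decidable (\<lambda>x. f x < g x)"
  using decidable_not [OF decidable_le [OF assms(2,1)]] by (simp add: not_le)

lemma decidable_eq:
  assumes "computable f" "computable g"
  shows "decidable (\<lambda>x. f x = g x)"
  using decidable_conj [OF decidable_le [OF assms] decidable_le [OF assms(2,1)]]
  by (simp only: order_eq_iff [of "f _" "g _", symmetric])

section \<open>Bounded quantifiers and finite sums\<close>

lemma decidable_bex:
  assumes "computable b" "decidable (\<lambda>z. P (pfst z) (psnd z))"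
  shows "decidable (\<lambda>x. \<exists>i<b x. P x i)"
proof -
  have P: "decidable (\<lambda>z. P (f z) (g z))" if "computable f" "computable g" for f g
    using decidable_compose [OF assms(2) computable_pair [OF that]] by simp
  have "computable (\<lambda>x. rec_nat 0 (\<lambda>m r. if P x m then 1 else r) (b x))"
    by (intro computable_rec computable_const assms(1) computable_if P computable_fst
        computable_snd computable_id)
  moreover have "rec_nat 0 (\<lambda>m r. if P x m then 1 else r) k = (of_bool (\<exists>i<k. P x i) :: nat)" for x k
    by (induction k) (auto simp: less_Suc_eq)
  ultimately show ?thesis by (simp only: decidable_def)
qed

lemma decidable_ball:
  assumes "computable b" "decidable (\<lambda>z. P (pfst z) (psnd z))"
  shows "decidable (\<lambda>x. \<forall>i<b x. P x i)"
  using decidable_not [OF decidable_bex [OF assms(1) decidable_not [OF assms(2)]]] by simp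

lemma computable_sum:
  assumes "computable b" "computable (\<lambda>z. f (pfst z) (psnd z))"
  shows "computable (\<lambda>x. \<Sum>i<b x. f x i)"
proof -
  have f: "computable (\<lambda>z. f (u z) (v z))" if "computable u" "computable v" for u v
    using computable_compose [OF assms(2) computable_pair [OF that]] by simp
  have "computable (\<lambda>x. rec_nat 0 (\<lambda>m r. r + f x m) (b x))"
    by (intro computable_rec computable_const assms(1) computable_add f computable_fst
        computable_snd computable_id)
  moreover have "rec_nat 0 (\<lambda>m r. r + f x m) k = (\<Sum>i<k. f x i)" for x k
    by (induction k) auto
  ultimately show ?thesis by simp
qed

section \<open>Unbounded search and division\<close>

lemma run_Minim_total:
  assumes "\<forall>z. run p z = Some (f (pfst z) (psnd z))"
  shows "run (Minim p) x = (if \<exists>n. f x n = 0 then Some (LEAST n. f x n = 0) else None)"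
proof -
  \<comment> \<open>For a total p the first zero is preceded by positive values only, so the side
    condition of \<open>Minim\<close> reduces to the existence of a zero.\<close>
  have "\<exists>n. f x n = 0 \<and> (\<forall>m<n. \<exists>v. f x m = Suc v)" if "\<exists>n. f x n = 0"
    using LeastI_ex [OF that] not_less_Least [of _ "\<lambda>n. f x n = 0"] not0_implies_Suc by blast
  then have "(\<exists>n. f x n = 0 \<and> (\<forall>m<n. \<exists>v. f x m = Suc v)) \<longleftrightarrow> (\<exists>n. f x n = 0)"
    by blast
  moreover have "run p (prod_encode (x, n)) = Some (f x n)" for n
    by (simp add: assms)
  ultimately show ?thesis
    by (simp only: run.simps option.inject)
qed

lemma computable_Least:
  assumes "decidable (\<lambda>z. P (pfst z) (psnd z))" and ex: "\<And>x. \<exists>n. P x n"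
  shows "computable (\<lambda>x. LEAST n. P x n)"
proof -
  have "computable (\<lambda>z. of_bool (\<not> P (pfst z) (psnd z)))"
    by (intro computable_of_bool decidable_not assms)
  then obtain p where p: "\<forall>z. run p z = Some (of_bool (\<not> P (pfst z) (psnd z)))"
    unfolding computable_def by blast
  have "run (Minim p) x = Some (LEAST n. P x n)" for x
    using run_Minim_total [where f = "\<lambda>x n. of_bool (\<not> P x n)", OF p, of x] ex [of x]
    by (simp only: of_bool_eq_0_iff not_not if_True)
  then show ?thesis
    unfolding computable_def by blast
qed

lemma computable_div:
  assumes f: "computable f" and g: "computable g"
  shows "computable (\<lambda>x. f x div g x)"
proof -
  \<comment> \<open>The quotient is found by search. The disjunct b = 0 keeps the search total and
    makes it stop at 0, in accordance with a div 0 = 0.\<close>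
  have "(LEAST k. a < b * Suc k \<or> b = 0) = a div b" for a b :: nat
  proof (cases "b = 0")
    case False
    then have "a < b * Suc k \<longleftrightarrow> a div b \<le> k" for k
      using div_less_iff_less_mult [of b a "Suc k"] by (simp only: less_Suc_eq_le mult.commute)
    then show ?thesis
      using False by (simp only: simp_thms) (rule Least_equality, auto)
  qed auto
  moreover have "computable (\<lambda>x. LEAST k. f x < g x * Suc k \<or> g x = 0)"
  proof (rule computable_Least)
    show "\<exists>k. f x < g x * Suc k \<or> g x = 0" for x
      by (rule exI [of _ "f x"]) (cases "g x"; simp)
    show "decidable (\<lambda>z. f (pfst z) < g (pfst z) * Suc (psnd z) \<or> g (pfst z) = 0)"
      by (intro decidable_disj decidable_less decidable_eq computable_mult computable_Suc
          computable_compose [OF f] computable_compose [OF g] computable_const computable_fst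
          computable_snd computable_id)
  qed
  ultimately show ?thesis by simp
qed

lemma computable_mod:
  assumes "computable f" "computable g"
  shows "computable (\<lambda>x. f x mod g x)"
proof -
  have "computable (\<lambda>x. f x - f x div g x * g x)"
    by (intro computable_diff computable_mult computable_div assms)
  then show ?thesis
    by (simp only: minus_div_mult_eq_mod)
qed

lemma decidable_set_decode:
  assumes "computable f" "computable g"
  shows "decidable (\<lambda>x. f x \<in> set_decode (g x))"
proof -
  have "decidable (\<lambda>x. g x div 2 ^ f x mod 2 = 1)"
    by (intro decidable_eq computable_mod computable_div computable_power2 computable_const assms)
  then show ?thesis
    by (simp add: set_decode_def odd_iff_mod_2_eq_one)
qed

lemmas computable_intros =
  computable_const computable_id computable_pair computable_fst computable_snd computable_Suc
  computable_add computable_diff computable_mult computable_power2 computable_div computable_mod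
  computable_if computable_of_bool
  decidable_const decidable_not decidable_conj decidable_disj decidable_if decidable_le
  decidable_less decidable_eq decidable_bex decidable_ball decidable_set_decode

text \<open>The values of f below c are stored in one number, a nested pair with the latest value on
  top, and g computes f c from c and this history.\<close>

lemma computable_course_of_values:
  assumes g: "computable (\<lambda>z. g (pfst z) (psnd z))"
    and f: "\<And>c. f c = g c (rec_nat 0 (\<lambda>m r. prod_encode (f m, r)) c)"
  shows "computable f"
proof -
  let ?H = "\<lambda>c. rec_nat 0 (\<lambda>m r. prod_encode (f m, r)) c"
  have g': "computable (\<lambda>x. g (u x) (v x))" if "computable u" "computable v" for u v
    using computable_compose [OF g computable_pair [OF that]] by simp
  \<comment> \<open>The next entry of the history is computed by g from the history so far. This
    removes f from the recursion and makes the history primitive recursive.\<close>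
  have H: "?H c = rec_nat 0 (\<lambda>m r. prod_encode (g m r, r)) c" for c
  proof (induction c)
    case (Suc c)
    have "f c = g c (rec_nat 0 (\<lambda>m r. prod_encode (g m r, r)) c)"
      by (subst f) (simp only: Suc)
    then show ?case
      using Suc by (simp only: nat.rec)
  qed simp
  have "computable ?H"
    unfolding H by (intro computable_rec g' computable_intros)
  then have "computable (\<lambda>c. g c (?H c))"
    by (intro g' computable_id)
  then show ?thesis
    by (simp only: f [symmetric])
qed

definition history_nth :: "nat \<Rightarrow> nat \<Rightarrow> nat" where
  "history_nth h i = pfst ((psnd ^^ i) h)"

text \<open>In a history of length c the entries for i + 1, ..., c - 1 lie above the one for i,
  hence the depth \<open>c - Suc i\<close>.\<close>

lemma history_nth:
  assumes "i < c"
  shows "history_nth (rec_nat 0 (\<lambda>m r. prod_encode (f m, r)) c) (c - Suc i) = f i"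
  using assms
proof (induction c)
  case (Suc c)
  show ?case
  proof (cases "i = c")
    case False
    then have "Suc c - Suc i = Suc (c - Suc i)" "i < c"
      using Suc by auto
    then show ?thesis
      using Suc by (simp add: history_nth_def funpow_Suc_right del: funpow.simps)
  qed (simp add: history_nth_def)
qed simp

lemma computable_history_nth:
  assumes "computable f" "computable g"
  shows "computable (\<lambda>x. history_nth (f x) (g x))"
proof -
  have "(psnd ^^ i) h = rec_nat h (\<lambda>m r. psnd r) i" for i h
    by (induction i) auto
  then show ?thesis
    unfolding history_nth_def by (simp, intro computable_rec computable_intros assms)
qed


section \<open>Enumeration of c.e. sets in stages\<close>

lemma computable_set_encode:
  assumes "computable b" "decidable (\<lambda>z. P (pfst z) (psnd z))"
  shows "computable (\<lambda>x. set_encode {i. i < b x \<and> P x i})"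
proof -
  have "set_encode {i. i < b x \<and> P x i} = (\<Sum>i<b x. if P x i then 2 ^ i else 0)" for x
  proof -
    have "set_encode {i. i < b x \<and> P x i} = sum ((^) 2) {i \<in> {..<b x}. P x i}"
      by (simp add: set_encode_def)
    then show ?thesis
      by (subst (asm) sum.inter_filter) simp_all
  qed
  moreover have "computable (\<lambda>x. \<Sum>i<b x. if P x i then 2 ^ i else 0)"
    by (intro computable_sum computable_intros assms)
  ultimately show ?thesis
    by simp
qed

text \<open>Each element is an exponent in the binary expansion of the index. The resulting bound
  turns a search among the elements into a bounded quantifier.\<close>

lemma less_if_mem_set_decode:
  assumes "x \<in> set_decode D"
  shows "x < D"
proof -
  have "D div 2 ^ x \<noteq> 0"
    using assms by (auto simp: set_decode_def intro: Nat.gr0I)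
  then have "2 ^ x \<le> D"
    by (simp add: div_eq_0_iff)
  then show ?thesis
    using less_exp [of x] by linarith
qed

section \<open>Derivations of computations\<close>

definition judgement :: "nat \<Rightarrow> nat \<Rightarrow> nat \<Rightarrow> nat" where
  "judgement e x y = prod_encode (e, prod_encode (x, y))"

lemma judgement_le: "x \<le> judgement e x y" "y \<le> judgement e x y"
  unfolding judgement_def by (meson le_prod_encode_1 le_prod_encode_2 le_trans)+

text \<open>
  The last step of a derivation of \<^prop>\<open>run (prog_of e) x = Some y\<close> whose premises are coded
  by elements of \<open>S\<close>.
\<close>

definition derivable :: "nat set \<Rightarrow> nat \<Rightarrow> nat \<Rightarrow> nat \<Rightarrow> bool" where
  "derivable S e x y \<longleftrightarrow>
     (if e = 0 then y = 0 else if e = 1 then y = Suc x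
      else if e = 2 then y = pfst x else if e = 3 then y = psnd x
      else if (e - 4) mod 4 = 0 then
        judgement (pfst ((e - 4) div 4)) x (pfst y) \<in> S \<and>
        judgement (psnd ((e - 4) div 4)) x (psnd y) \<in> S
      else if (e - 4) mod 4 = 1 then
        \<exists>u. judgement (psnd ((e - 4) div 4)) x u \<in> S \<and>
            judgement (pfst ((e - 4) div 4)) u y \<in> S
      else if (e - 4) mod 4 = 2 then
        if psnd x = 0 then judgement (pfst ((e - 4) div 4)) (pfst x) y \<in> S
        else \<exists>v. judgement e (prod_encode (pfst x, psnd x - 1)) v \<in> S \<and>
             judgement (psnd ((e - 4) div 4))
               (prod_encode (pfst x, prod_encode (psnd x - 1, v))) y \<in> S
      else judgement ((e - 4) div 4) (prod_encode (x, y)) 0 \<in> S \<and>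
        (\<forall>i<y. \<exists>v. judgement ((e - 4) div 4) (prod_encode (x, i)) (Suc v) \<in> S))"

lemma derivable_mono: "derivable S e x y \<Longrightarrow> S \<subseteq> T \<Longrightarrow> derivable T e x y"
  unfolding derivable_def by (simp split: if_splits) blast+

text \<open>Each step has finitely many premises: at most two, or y + 1 for a minimisation with
  result y. A step from an increasing union is therefore a step from one of its members.\<close>

lemma derivable_finite_support:
  assumes "derivable S e x y"
  shows "\<exists>F. finite F \<and> F \<subseteq> S \<and> derivable F e x y"
proof -
  have two: "\<exists>F. finite F \<and> F \<subseteq> S \<and> u \<in> F \<and> v \<in> F" if "u \<in> S" "v \<in> S" for u v
    using that by (intro exI [of _ "{u, v}"]) auto
  have one: "\<exists>F. finite F \<and> F \<subseteq> S \<and> u \<in> F" if "u \<in> S" for u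
    using that by (intro exI [of _ "{u}"]) auto
  have many: "\<exists>F. finite F \<and> F \<subseteq> S \<and> u \<in> F \<and> (\<forall>i<y. \<exists>v. f i v \<in> F)"
    if "u \<in> S" and ex: "\<forall>i<y. \<exists>v. f i v \<in> S" for u and f :: "nat \<Rightarrow> nat \<Rightarrow> nat"
  proof -
    obtain g where "\<forall>i<y. f i (g i) \<in> S"
      using ex by metis
    then show ?thesis
      using that by (intro exI [of _ "insert u ((\<lambda>i. f i (g i)) ` {..<y})"]) auto
  qed
  have "(e - 4) mod 4 < 4"
    by simp
  then have "(e - 4) mod 4 = 0 \<or> (e - 4) mod 4 = 1 \<or> (e - 4) mod 4 = 2 \<or> (e - 4) mod 4 = 3"
    by linarith
  then consider "e < 4" | "\<not> e < 4" "(e - 4) mod 4 = 0" | "\<not> e < 4" "(e - 4) mod 4 = 1"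
    | "\<not> e < 4" "(e - 4) mod 4 = 2" "psnd x = 0" | "\<not> e < 4" "(e - 4) mod 4 = 2" "psnd x \<noteq> 0"
    | "\<not> e < 4" "(e - 4) mod 4 = 3"
    by (elim disjE; cases "e < 4"; cases "psnd x = 0"; simp)
  then show ?thesis
  proof cases
    case 1
    then show ?thesis
      using assms by (intro exI [of _ "{}"]) (auto simp: derivable_def)
  next
    case 2
    then show ?thesis
      using assms two by (simp add: derivable_def)
  next
    case 3
    then show ?thesis
      using assms two by (simp add: derivable_def) meson
  next
    case 4
    then show ?thesis
      using assms one by (simp add: derivable_def)
  next
    case 5
    then show ?thesis
      using assms two by (simp add: derivable_def) meson
  next
    case 6
    then show ?thesis
      using assms many by (simp add: derivable_def)
  qed
qed

text \<open>The only unbounded quantifiers in \<open>derivable\<close> range over outputs of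
  premises. An output is at most the code of its judgement, and this code is less than the canonical
  index of the set containing it.\<close>

lemma decidable_derivable:
  assumes D: "computable D" and e: "computable e" and x: "computable x" and y: "computable y"
  shows "decidable (\<lambda>z. derivable (set_decode (D z)) (e z) (x z) (y z))"
proof -
  have bound: "(\<exists>v. judgement (a v) (b v) (c v) \<in> set_decode d \<and> Q v) \<longleftrightarrow>
      (\<exists>v<d. judgement (a v) (b v) (c v) \<in> set_decode d \<and> Q v)"
    if "\<And>v. v \<le> c v" for a b c d and Q :: "nat \<Rightarrow> bool"
    using that less_if_mem_set_decode judgement_le(2) le_less_trans le_trans by meson
  have bound1: "(\<exists>v. judgement a b (Suc v) \<in> set_decode d) \<longleftrightarrow>
      (\<exists>v<d. judgement a b (Suc v) \<in> set_decode d)" for a b d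
    using bound [of Suc "\<lambda>_. a" "\<lambda>_. b" d "\<lambda>_. True"] by simp
  note intros = computable_intros computable_compose [OF D] computable_compose [OF e]
    computable_compose [OF x] computable_compose [OF y]
  show ?thesis
    unfolding derivable_def bound1 bound [where c = "\<lambda>v. v", OF order_refl]
    unfolding judgement_def
    by (intro intros)
qed

text \<open>One more derivation step per stage, restricted to codes below the stage number. The
  restriction keeps every stage finite, and so representable by a canonical index, while no code is
  excluded forever.\<close>

primrec derived :: "nat \<Rightarrow> nat set" where
  "derived 0 = {}"
| "derived (Suc s) =
     {j. j < Suc s \<and> derivable (derived s) (pfst j) (pfst (psnd j)) (psnd (psnd j))}"

lemma finite_derived: "finite (derived s)"
  by (cases s) auto

lemma derived_less: "j \<in> derived s \<Longrightarrow> j < s"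
  by (cases s) auto

lemma mono_derived: "mono derived"
proof (rule mono_iff_le_Suc [THEN iffD2, rule_format])
  show "derived s \<subseteq> derived (Suc s)" for s
  proof (induction s)
    case (Suc s)
    show ?case
      using derivable_mono [OF _ Suc] by auto
  qed simp
qed

lemma derived_closed:
  assumes "derivable (\<Union>s. derived s) e x y"
  shows "\<exists>s. judgement e x y \<in> derived s"
proof -
  obtain F where F: "finite F" "F \<subseteq> (\<Union>s. derived s)" "derivable F e x y"
    using derivable_finite_support [OF assms] by blast
  have "\<exists>s. F \<subseteq> derived s"
    using F(1,2)
  proof induction
    case (insert j F)
    then obtain s t where "F \<subseteq> derived s" "j \<in> derived t"
      by auto
    then have "insert j F \<subseteq> derived (max s t)"
      using monoD [OF mono_derived, of s "max s t"] monoD [OF mono_derived, of t "max s t"]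
      by auto
    then show ?case ..
  qed simp
  then obtain s where s: "F \<subseteq> derived s" ..
  define t where "t = max s (judgement e x y)"
  have "derivable (derived t) e x y"
    using derivable_mono [OF F(3)] s monoD [OF mono_derived, of s t] by (auto simp: t_def)
  then have "judgement e x y \<in> derived (Suc t)"
    by (simp add: judgement_def t_def)
  then show ?thesis ..
qed

lemma computable_derived:
  assumes "computable f"
  shows "computable (\<lambda>x. set_encode (derived (f x)))"
proof -
  have "set_encode (derived s) =
      rec_nat 0 (\<lambda>m D. set_encode {j. j < Suc m \<and>
        derivable (set_decode D) (pfst j) (pfst (psnd j)) (psnd (psnd j))}) s" for s
  proof (induction s)
    case (Suc s)
    show ?case
      by (simp only: nat.rec Suc [symmetric] set_encode_inverse [OF finite_derived] derived.simps)
  qed simp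
  then show ?thesis
    by (simp only:) (intro computable_rec computable_set_encode decidable_derivable
        computable_intros assms)
qed

section \<open>Correctness of derivations with respect to \<open>run\<close>\<close>

lemma div_mod_4:
  "Suc (4 * m) div 4 = m" "Suc (4 * m) mod 4 = 1"
  "Suc (Suc (4 * m)) div 4 = m" "Suc (Suc (4 * m)) mod 4 = 2"
  "Suc (Suc (Suc (4 * m))) div 4 = m" "Suc (Suc (Suc (4 * m))) mod 4 = 3"
  for m :: nat
  by presburger+

text \<open>Reads the numbering backwards: the four indices below 4 are basic programs, and from 4
  on the residue modulo 4 selects the constructor.\<close>

lemma prog_of_cases:
  obtains (Zero) "e = 0" "prog_of e = Zero"
  | (Succ) "e = 1" "prog_of e = Succ"
  | (Left) "e = 2" "prog_of e = Left"
  | (Right) "e = 3" "prog_of e = Right"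
  | (Split) a b where "e = 4 + 4 * prod_encode (a, b)" "prog_of e = Split (prog_of a) (prog_of b)"
  | (Comp) a b where "e = 5 + 4 * prod_encode (a, b)" "prog_of e = Comp (prog_of a) (prog_of b)"
  | (PrimRec) a b where "e = 6 + 4 * prod_encode (a, b)"
      "prog_of e = PrimRec (prog_of a) (prog_of b)"
  | (Minim) m where "e = 7 + 4 * m" "prog_of e = Minim (prog_of m)"
proof -
  define m where "m = (e - 4) div 4"
  have m: "m = prod_encode (pfst m, psnd m)"
    by simp
  consider "e < 4" | "e = 4 + 4 * m" | "e = 5 + 4 * m" | "e = 6 + 4 * m" | "e = 7 + 4 * m"
    unfolding m_def by linarith
  then show thesis
  proof cases
    case 1
    then consider "e = 0" | "e = 1" | "e = 2" | "e = 3"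
      by linarith
    then show thesis
      by cases (use that(1-4) in \<open>simp_all add: prog_of.simps\<close>)
  next
    case 2
    have "prog_of e = Split (prog_of (pfst m)) (prog_of (psnd m))"
      by (subst prog_of.simps) (simp add: 2 Let_def div_mod_4)
    with 2 m show thesis
      using that(5) by metis
  next
    case 3
    have "prog_of e = Comp (prog_of (pfst m)) (prog_of (psnd m))"
      by (subst prog_of.simps) (simp add: 3 Let_def div_mod_4)
    with 3 m show thesis
      using that(6) by metis
  next
    case 4
    have "prog_of e = PrimRec (prog_of (pfst m)) (prog_of (psnd m))"
      by (subst prog_of.simps) (simp add: 4 Let_def div_mod_4)
    with 4 m show thesis
      using that(7) by metis
  next
    case 5
    have "prog_of e = Minim (prog_of m)"
      by (subst prog_of.simps) (simp add: 5 Let_def div_mod_4)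
    with 5 show thesis
      using that(8) by metis
  qed
qed

lemma prog_of_Split: "prog_of (4 + 4 * prod_encode (a, b)) = Split (prog_of a) (prog_of b)"
  and prog_of_Comp: "prog_of (5 + 4 * prod_encode (a, b)) = Comp (prog_of a) (prog_of b)"
  by (subst prog_of.simps, simp add: Let_def div_mod_4)+

lemma derivable_intros:
  "derivable S (4 + 4 * prod_encode (a, b)) x y \<longleftrightarrow>
     judgement a x (pfst y) \<in> S \<and> judgement b x (psnd y) \<in> S"
  "derivable S (5 + 4 * prod_encode (a, b)) x y \<longleftrightarrow>
     (\<exists>u. judgement b x u \<in> S \<and> judgement a u y \<in> S)"
  "derivable S (6 + 4 * prod_encode (a, b)) (prod_encode (c, 0)) y \<longleftrightarrow> judgement a c y \<in> S"
  "derivable S (6 + 4 * prod_encode (a, b)) (prod_encode (c, Suc n)) y \<longleftrightarrow>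
     (\<exists>v. judgement (6 + 4 * prod_encode (a, b)) (prod_encode (c, n)) v \<in> S \<and>
       judgement b (prod_encode (c, prod_encode (n, v))) y \<in> S)"
  "derivable S (7 + 4 * m) x y \<longleftrightarrow>
     judgement m (prod_encode (x, y)) 0 \<in> S \<and>
     (\<forall>i<y. \<exists>v. judgement m (prod_encode (x, i)) (Suc v) \<in> S)"
  by (simp_all add: derivable_def div_mod_4)

lemma derivable_sound:
  assumes S: "\<And>e x y. judgement e x y \<in> S \<Longrightarrow> run (prog_of e) x = Some y"
    and "derivable S e x y"
  shows "run (prog_of e) x = Some y"
proof (cases rule: prog_of_cases [of e])
  case (Split a b)
  then show ?thesis
    using assms(2) S [of a x "pfst y"] S [of b x "psnd y"] by (simp add: derivable_intros)
next
  case (Comp a b)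
  then show ?thesis
    using assms(2) S [of a _ y] S [of b x] unfolding Comp derivable_intros by auto
next
  case (PrimRec a b)
  obtain c n where x: "x = prod_encode (c, n)"
    by (metis prod_decode_inverse surj_pair)
  show ?thesis
  proof (cases n)
    case 0
    then show ?thesis
      using assms(2) S [of a c y] unfolding x 0 PrimRec(2)
      unfolding PrimRec(1) derivable_intros by simp
  next
    case (Suc k)
    then obtain v where "run (prog_of e) (prod_encode (c, k)) = Some v"
      "run (prog_of b) (prod_encode (c, prod_encode (k, v))) = Some y"
      using assms(2) S by (auto simp: derivable_intros PrimRec(1) x)
    then show ?thesis
      by (simp add: PrimRec(2) x Suc)
  qed
next
  case (Minim m)
  have y: "run (prog_of m) (prod_encode (x, y)) = Some 0"
    and less: "\<forall>i<y. \<exists>v. run (prog_of m) (prod_encode (x, i)) = Some (Suc v)"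
    using assms(2) S by (simp_all add: derivable_intros Minim(1)) blast+
  have "(LEAST n. run (prog_of m) (prod_encode (x, n)) = Some 0) = y"
  proof (rule Least_equality)
    show "y \<le> n" if "run (prog_of m) (prod_encode (x, n)) = Some 0" for n
      using less that by (metis Suc_neq_Zero not_le option.inject)
  qed (rule y)
  then show ?thesis
    using y less by (auto simp: Minim(2))
qed (use assms(2) in \<open>simp_all add: derivable_def\<close>)

lemma derived_sound: "judgement e x y \<in> derived s \<Longrightarrow> run (prog_of e) x = Some y"
proof (induction s arbitrary: e x y)
  case (Suc s)
  then have "derivable (derived s) e x y"
    by (simp add: judgement_def)
  then show ?case
    using derivable_sound Suc.IH by metis
qed simp

text \<open>Induction on the index works because subprograms have smaller indices. Only
  \<open>PrimRec\<close> has a premise with the same index; it is handled by an inner induction on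
  the recursion depth.\<close>

lemma derived_complete: "run (prog_of e) x = Some y \<Longrightarrow> \<exists>s. judgement e x y \<in> derived s"
proof (induction e arbitrary: x y rule: less_induct)
  case (less e)
  define U where "U = (\<Union>s. derived s)"
  have closed: "\<exists>s. judgement a x y \<in> derived s" if "derivable U a x y" for a x y
    using derived_closed that unfolding U_def .
  have IH: "judgement a x y \<in> U" if "a < e" "run (prog_of a) x = Some y" for a x y
    using less.IH [OF that] by (simp add: U_def)
  show ?case
  proof (cases rule: prog_of_cases [of e])
    case (Split a b)
    then have "a < e" "b < e"
      using le_prod_encode_1 [of a b] le_prod_encode_2 [of b a] by linarith+
    moreover obtain u v where "run (prog_of a) x = Some u" "run (prog_of b) x = Some v"
        "y = prod_encode (u, v)"
      using less.prems Split(2) by (auto simp: bind_eq_Some_conv)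
    ultimately have "judgement a x (pfst y) \<in> U \<and> judgement b x (psnd y) \<in> U"
      using IH by simp
    then have "derivable U e x y"
      unfolding Split(1) derivable_intros .
    then show ?thesis
      by (rule closed)
  next
    case (Comp a b)
    then have "a < e" "b < e"
      using le_prod_encode_1 [of a b] le_prod_encode_2 [of b a] by linarith+
    moreover obtain u where "run (prog_of b) x = Some u" "run (prog_of a) u = Some y"
      using less.prems Comp(2) by (auto simp: bind_eq_Some_conv)
    ultimately have "\<exists>u. judgement b x u \<in> U \<and> judgement a u y \<in> U"
      using IH by blast
    then have "derivable U e x y"
      unfolding Comp(1) derivable_intros .
    then show ?thesis
      by (rule closed)
  next
    case (PrimRec a b)
    then have lt: "a < e" "b < e"
      using le_prod_encode_1 [of a b] le_prod_encode_2 [of b a] by linarith+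
    have "\<exists>s. judgement e (prod_encode (c, n)) y \<in> derived s"
      if "run (prog_of e) (prod_encode (c, n)) = Some y" for c n y
      using that
    proof (induction n arbitrary: y)
      case 0
      then have "run (prog_of a) c = Some y"
        by (simp add: PrimRec(2))
      then have "derivable U e (prod_encode (c, 0)) y"
        unfolding PrimRec(1) derivable_intros by (rule IH [OF lt(1)])
      then show ?case
        by (rule closed)
    next
      case (Suc n)
      then obtain v where "run (prog_of e) (prod_encode (c, n)) = Some v"
        "run (prog_of b) (prod_encode (c, prod_encode (n, v))) = Some y"
        by (auto simp: PrimRec(2) bind_eq_Some_conv)
      then have "judgement e (prod_encode (c, n)) v \<in> U"
        "judgement b (prod_encode (c, prod_encode (n, v))) y \<in> U"
        using Suc.IH IH [OF lt(2)] by (simp_all add: U_def)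
      then have "derivable U e (prod_encode (c, Suc n)) y"
        unfolding PrimRec(1) derivable_intros by blast
      then show ?case
        by (rule closed)
    qed
    then show ?thesis
      using less.prems by (metis prod_decode_inverse surj_pair)
  next
    case (Minim m)
    define P where "P n = run (prog_of m) (prod_encode (x, n))" for n
    have "\<exists>n. P n = Some 0 \<and> (\<forall>k<n. \<exists>v. P k = Some (Suc v))" and y: "y = (LEAST n. P n = Some 0)"
      using less.prems by (auto simp: Minim(2) P_def split: if_splits)
    then obtain n where n: "P n = Some 0" "\<forall>k<n. \<exists>v. P k = Some (Suc v)"
      by blast
    have "y = n"
      unfolding y
    proof (rule Least_equality)
      show "n \<le> k" if "P k = Some 0" for k
        using n(2) that by (metis Suc_neq_Zero not_le option.inject)
    qed (rule n)
    moreover have "m < e"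
      using Minim(1) by linarith
    ultimately have "judgement m (prod_encode (x, y)) 0 \<in> U"
      "\<forall>i<y. \<exists>v. judgement m (prod_encode (x, i)) (Suc v) \<in> U"
      using n IH [of m] unfolding P_def by blast+
    then have "derivable U e x y"
      unfolding Minim(1) derivable_intros by blast
    then show ?thesis
      by (rule closed)
  qed (use less.prems in \<open>auto intro!: closed simp: derivable_def\<close>)
qed

section \<open>Finite stages of c.e. sets\<close>

definition stage :: "nat \<Rightarrow> nat \<Rightarrow> nat set" where
  "stage e s = {x. x < s \<and> (\<exists>y<s. judgement e x y \<in> derived s)}"

lemma finite_stage: "finite (stage e s)"
  by (simp add: stage_def)

lemma mono_stage: "mono (stage e)"
proof (rule monoI)
  show "stage e s \<subseteq> stage e t" if "s \<le> t" for s t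
    using that monoD [OF mono_derived that] unfolding stage_def
    by (auto intro: order_less_le_trans)
qed

text \<open>The bounds in \<open>stage\<close> lose nothing: every code in \<open>derived s\<close>
  is below s and is at least its input and its output. Their purpose is to make membership a bounded
  search.\<close>

lemma Union_stage: "(\<Union>s. stage e s) = W e"
proof -
  have "x \<in> stage e s \<longleftrightarrow> (\<exists>y. judgement e x y \<in> derived s)" for x s
  proof -
    have "x < s \<and> y < s" if "judgement e x y \<in> derived s" for y
      using derived_less [OF that] judgement_le [of x e y] judgement_le(2) [of y e x] by linarith
    then show ?thesis
      unfolding stage_def by blast
  qed
  then show ?thesis
    unfolding W_def dom_def using derived_sound [of e] derived_complete [of e]
    by (simp add: set_eq_iff) blast
qed

lemma decidable_stage:
  assumes "computable x" "computable e" "computable s"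
  shows "decidable (\<lambda>z. x z \<in> stage (e z) (s z))"
proof -
  note intros = computable_intros computable_derived assms [THEN computable_compose] assms
  have "decidable (\<lambda>z. x z < s z \<and>
      (\<exists>y<s z. judgement (e z) (x z) y \<in> set_decode (set_encode (derived (s z)))))"
    unfolding judgement_def by (intro intros)
  then show ?thesis
    by (simp add: stage_def set_encode_inverse finite_derived)
qed

lemma computable_stage:
  assumes "computable e" "computable s"
  shows "computable (\<lambda>z. set_encode (stage (e z) (s z)))"
proof -
  have eq: "stage e s = {i. i < s \<and> i \<in> stage e s}" for e s
    by (auto simp: stage_def)
  have "computable (\<lambda>z. set_encode {i. i < s z \<and> i \<in> stage (e z) (s z)})"
    by (intro computable_set_encode decidable_stage computable_intros
        assms [THEN computable_compose] assms)
  then show ?thesis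
    by (simp only: eq [symmetric])
qed


section \<open>Parametrization and the recursion theorem\<close>

text \<open>The s-m-n function. The index is that of the program e composed with a
  \<open>Split\<close> of the constant k and the identity; the constant is obtained by composing
  \<open>Succ\<close> k times with \<open>Zero\<close>, whose index is 0.\<close>

definition curry_index :: "nat \<Rightarrow> nat \<Rightarrow> nat" where
  "curry_index e k = 5 + 4 * prod_encode (e, 4 + 4 * prod_encode
     (rec_nat 0 (\<lambda>m r. 5 + 4 * prod_encode (1, r)) k, 4 + 4 * prod_encode (2, 3)))"

lemma run_curry_index: "run (prog_of (curry_index e k)) x = run (prog_of e) (prod_encode (k, x))"
proof -
  have "prog_of 1 = Succ" "prog_of 2 = Left" "prog_of 3 = Right"
    by (simp_all add: prog_of.simps)
  moreover have "run (prog_of (rec_nat 0 (\<lambda>m r. 5 + 4 * prod_encode (1, r)) k)) x = Some k"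
  proof (induction k)
    case 0
    show ?case
      by (simp add: prog_of.simps)
  next
    case (Suc k)
    then show ?case
      using \<open>prog_of 1 = Succ\<close> by (simp only: nat.rec prog_of_Comp run.simps) simp
  qed
  ultimately show ?thesis
    unfolding curry_index_def prog_of_Comp prog_of_Split by simp
qed

lemma computable_curry_index:
  "computable f \<Longrightarrow> computable g \<Longrightarrow> computable (\<lambda>x. curry_index (f x) (g x))"
  unfolding curry_index_def by (intro computable_rec computable_intros) simp_all

text \<open>The program searches for a witness s by minimisation. It halts exactly on the inputs
  that have one, so its domain is the projection of P.\<close>

lemma semidecidable_index:
  assumes "decidable (\<lambda>z. P (pfst z) (psnd z))"
  obtains e where "W e = {x. \<exists>s. P x s}"
proof -
  obtain p where p: "\<forall>z. run p z = Some (of_bool (\<not> P (pfst z) (psnd z)))"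
    using computable_of_bool [OF decidable_not [OF assms]] unfolding computable_def by blast
  obtain e where "prog_of e = Minim p"
    using surj_prog_of by (metis surjD)
  then have "W e = {x. \<exists>s. P x s}"
    unfolding W_def dom_def
    using run_Minim_total [where f = "\<lambda>x n. of_bool (\<not> P x n)", OF p] by simp
  then show thesis ..
qed

lemma parametrized_index:
  assumes "decidable (\<lambda>z. P (pfst (pfst z)) (psnd (pfst z)) (psnd z))"
  obtains h where "computable h" "\<And>e. W (h e) = {x. \<exists>s. P e x s}"
proof -
  obtain m where m: "W m = {z. \<exists>s. P (pfst z) (psnd z) s}"
    using semidecidable_index [OF assms] .
  have "W (curry_index m e) = {x. \<exists>s. P e x s}" for e
  proof -
    have "W (curry_index m e) = {x. prod_encode (e, x) \<in> W m}"
      by (auto simp: W_def run_curry_index)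
    then show ?thesis
      by (simp add: m)
  qed
  moreover have "computable (curry_index m)"
    using computable_curry_index [OF computable_const computable_id] .
  ultimately show thesis
    using that by blast
qed

text \<open>Kleene's recursion theorem by self-application: on the pair (x, y) the program m runs p
  on (\<open>curry_index x x\<close>, y), so \<open>curry_index m m\<close> is the required fixed
  point.\<close>

lemma recursion_theorem:
  obtains e where "\<And>x. run (prog_of e) x = run p (prod_encode (e, x))"
proof -
  have "computable (\<lambda>x. curry_index x x)"
    by (intro computable_curry_index computable_id)
  then obtain d where d: "\<forall>x. run d x = Some (curry_index x x)"
    unfolding computable_def by blast
  obtain m where m: "prog_of m = Comp p (Split (Comp d Left) Right)"
    using surj_prog_of by (metis surjD)
  have "run (prog_of (curry_index m m)) x = run p (prod_encode (curry_index m m, x))" for x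
    by (simp add: run_curry_index m d)
  then show thesis ..
qed

text \<open>One fixed point e provides a whole family of indices \<open>curry_index e i\<close>,
  each of which may refer to all the others. This replaces a simultaneous recursion theorem for two
  indices.\<close>

lemma recursion_theorem_index:
  assumes "decidable (\<lambda>z. P (pfst (pfst z)) (pfst (psnd (pfst z))) (psnd (psnd (pfst z))) (psnd z))"
  obtains e where "\<And>i. W (curry_index e i) = {x. \<exists>s. P e i x s}"
proof -
  obtain m where m: "W m = {z. \<exists>s. P (pfst z) (pfst (psnd z)) (psnd (psnd z)) s}"
    using semidecidable_index [OF assms] .
  obtain e where e: "\<And>x. run (prog_of e) x = run (prog_of m) (prod_encode (e, x))"
    using recursion_theorem [of "prog_of m"] by blast
  have "W (curry_index e i) = {x. \<exists>s. P e i x s}" for i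
  proof -
    have "W (curry_index e i) = {x. prod_encode (e, prod_encode (i, x)) \<in> W m}"
      by (auto simp: W_def run_curry_index e)
    then show ?thesis
      by (simp add: m)
  qed
  then show thesis ..
qed


section \<open>Renaming of variables on codes of terms\<close>

text \<open>The counterpart of \<open>map\<close> on codes in the sense of \<open>tuple_of\<close>.
  The value 0 for length 0 is a default; proper symbols have positive arity.\<close>

primrec tuple_map :: "nat \<Rightarrow> (nat \<Rightarrow> nat) \<Rightarrow> nat \<Rightarrow> nat" where
  "tuple_map 0 \<phi> z = 0"
| "tuple_map (Suc a) \<phi> z =
     (if a = 0 then \<phi> z else prod_encode (\<phi> (pfst z), tuple_map a \<phi> (psnd z)))"

lemma tuple_of_tuple_map: "a > 0 \<Longrightarrow> tuple_of a (tuple_map a \<phi> z) = map \<phi> (tuple_of a z)"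
  by (induction a arbitrary: z) auto

text \<open>Components of a tuple are at most its code. Hence only values at small arguments are
  consulted, and a history can supply them.\<close>

lemma tuple_map_cong: "(\<And>y. y \<le> z \<Longrightarrow> \<phi> y = \<psi> y) \<Longrightarrow> tuple_map a \<phi> z = tuple_map a \<psi> z"
proof (induction a arbitrary: z)
  case (Suc a)
  have "tuple_map a \<phi> (psnd z) = tuple_map a \<psi> (psnd z)"
    by (rule Suc.IH) (use Suc.prems snd_prod_decode_le le_trans in blast)
  then show ?case
    using Suc.prems [of z] Suc.prems [OF fst_prod_decode_le] by simp
qed simp

lemma computable_tuple_map:
  assumes \<phi>: "computable (\<lambda>x. \<phi> (pfst x) (psnd x))" and "computable z"
  shows "computable (\<lambda>x. tuple_map a (\<phi> x) (z x))"
  using assms(2)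
proof (induction a arbitrary: z)
  case (Suc a)
  have \<phi>': "computable (\<lambda>x. \<phi> x (u x))" if "computable u" for u
    using computable_compose [OF \<phi> computable_pair [OF computable_id that]] by simp
  show ?case
    unfolding tuple_map.simps by (intro computable_intros \<phi>' Suc)
qed (simp add: computable_const)

text \<open>The computability of \<open>tuple_map\<close> is known for each fixed length only. As
  the signature is finite, a length depending on the argument is treated by finitely many
  cases.\<close>

lemma computable_cases:
  assumes "\<And>j. j < p \<Longrightarrow> computable (F j)" and j: "computable j"
  shows "computable (\<lambda>x. if j x < p then F (j x) x else 0)"
  using assms(1)
proof (induction p)
  case (Suc p)
  have "computable (\<lambda>x. if j x = p then F p x else if j x < p then F (j x) x else 0)"
    by (intro computable_intros j Suc) simp_all
  also have "(\<lambda>x. if j x = p then F p x else if j x < p then F (j x) x else 0) =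
      (\<lambda>x. if j x < Suc p then F (j x) x else 0)"
    by auto
  finally show ?case .
qed (simp add: computable_const)

section \<open>Equality and renaming of coded terms\<close>

lemma term_of_wrap:
  "proper_symbols ar = [] \<Longrightarrow> term_of ar k n = atoms ar k ! (n mod length (atoms ar k))"
  by (subst term_of.simps) (simp add: Let_def)

text \<open>Reduces equality of coded terms to arithmetic. With a proper symbol the numbering is
  injective; with constants only it is periodic, and the period is the number of atoms.\<close>

lemma term_of_eq_iff:
  assumes k: "k \<ge> 1"
  shows "term_of ar k m = term_of ar k n \<longleftrightarrow>
    (if proper_symbols ar = [] then m mod length (atoms ar k) = n mod length (atoms ar k) else m = n)"
proof (cases "proper_symbols ar = []")
  case True
  have "distinct (atoms ar k)" "length (atoms ar k) > 0"
    using k by (auto simp: atoms_def distinct_map inj_on_def)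
  then show ?thesis
    by (simp add: True term_of_wrap nth_eq_iff_index_eq)
next
  case False
  then show ?thesis
    using bij_betw_imp_inj_on [OF bij_term_of [OF k False]] by (simp add: inj_eq)
qed

lemma decidable_term_of_eq:
  assumes "k \<ge> 1" "computable f" "computable g"
  shows "decidable (\<lambda>x. term_of ar k (f x) = term_of ar k (g x))"
  unfolding term_of_eq_iff [OF assms(1)]
  by (intro computable_intros assms)

text \<open>Renaming keeps the outermost symbol j of a code q + (j + p * z) and acts on the tuple z
  of smaller codes, which is a course-of-values recursion. If all symbols are constants, treating
  the atoms suffices.\<close>

lemma term_of_rename_variables:
  assumes k: "k \<ge> 1" "k' \<ge> 1" and g: "\<And>i. i < k \<Longrightarrow> g i < k'" and comp: "computable g"
  obtains r where "computable r"
    "\<And>c. term_of ar k' (r c) = subst (\<lambda>i. Var (g i)) (term_of ar k c)"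
proof -
  define \<sigma> where "\<sigma> = (\<lambda>i. Var (g i))"
  define p where "p = length (proper_symbols ar)"
  define q where "q = length (atoms ar k)"
  define q' where "q' = length (atoms ar k')"
  \<comment> \<open>In \<open>atoms\<close> the constants follow the variables, so the position of a
    constant moves from offset k to offset k'.\<close>
  define atom where "atom i = (if i < k then g i else i - k + k')" for i
  have atom_comp: "computable (\<lambda>x. atom (f x))" if "computable f" for f
    unfolding atom_def by (intro computable_intros computable_compose [OF comp] that)
  have ne: "atoms ar k \<noteq> []" "atoms ar k' \<noteq> []"
    using k by (auto simp: atoms_def)
  have atom: "atom i < q'" "atoms ar k' ! atom i = subst \<sigma> (atoms ar k ! i)" if "i < q" for i
    using that g unfolding atom_def q_def q'_def \<sigma>_def
    by (auto simp: atoms_def nth_append) (use g in fastforce)+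
  show thesis
  proof (cases "p = 0")
    case True
    then have wrap: "proper_symbols ar = []"
      by (simp add: p_def)
    have "q > 0"
      using ne by (simp add: q_def)
    then have "term_of ar k' (atom (c mod q)) = subst \<sigma> (term_of ar k c)" for c
      using atom [of "c mod q"] by (simp add: term_of_wrap [OF wrap] term_of_atom q_def q'_def)
    moreover have "computable (\<lambda>c. atom (c mod q))"
      by (intro atom_comp computable_intros)
    ultimately show thesis
      using that unfolding \<sigma>_def by blast
  next
    case False
    then have proper: "proper_symbols ar \<noteq> []"
      by (simp add: p_def)
    \<comment> \<open>The map r on codes is first obtained without regard to computability.
      Injectivity of the numbering then forces it to satisfy the recursion given by G.\<close>
    have "\<exists>c'. term_of ar k' c' = subst \<sigma> (term_of ar k c)" for c
    proof -
      have "term_of ar k c \<in> terms ar {..<k}"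
        using range_term_of [OF k(1)] by blast
      then have "subst \<sigma> (term_of ar k c) \<in> terms ar {..<k'}"
        by induction (auto simp: \<sigma>_def g intro!: terms.intros)
      then show ?thesis
        using range_term_of [OF k(2)] by (metis imageE)
    qed
    then obtain r where r: "\<And>c. term_of ar k' (r c) = subst \<sigma> (term_of ar k c)"
      by metis
    define arity where "arity j = ar ! (proper_symbols ar ! j)" for j
    \<comment> \<open>The test against p always succeeds since p is positive here; it gives the term
      the form required by \<open>computable_cases\<close>.\<close>
    define G where "G c h =
      (if c < q then atom c
       else q' + ((c - q) mod p + p *
         (if (c - q) mod p < p then
            tuple_map (arity ((c - q) mod p)) (\<lambda>y. history_nth h (c - Suc y)) ((c - q) div p)
          else 0)))" for c h
    have G: "computable (\<lambda>z. G (pfst z) (psnd z))"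
      unfolding G_def
      by (intro computable_intros atom_comp computable_tuple_map computable_history_nth
          computable_cases [where F = "\<lambda>j z. tuple_map (arity j)
            (\<lambda>y. history_nth (psnd z) (pfst z - Suc y)) ((pfst z - q) div p)"])
    have "r c = G c (rec_nat 0 (\<lambda>m h. prod_encode (r m, h)) c)" for c
    proof (cases "c < q")
      case True
      then have "term_of ar k' (r c) = term_of ar k' (atom c)"
        using atom [of c] r by (simp add: term_of_atom q_def q'_def)
      then show ?thesis
        using True proper by (simp add: term_of_eq_iff [OF k(2)] G_def)
    next
      case ge: False
      define j z where "j = (c - q) mod p" and "z = (c - q) div p"
      have j: "j < p"
        using False by (simp add: j_def)
      have c: "c = q + (j + p * z)"
        using ge by (simp add: j_def z_def)
      have "z \<le> p * z" "q > 0"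
        using False ne by (simp_all add: q_def)
      then have "z < c"
        using c by linarith
      have "proper_symbols ar ! j \<in> set (proper_symbols ar)"
        using j by (simp add: p_def)
      then have "arity j > 0"
        by (simp add: proper_symbols_iff arity_def)
      have "term_of ar k' (r c) = subst \<sigma> (Fun (proper_symbols ar ! j)
          (map (term_of ar k) (tuple_of (arity j) z)))"
        using term_of_app [OF j [unfolded p_def] ne(1), of z] c r [of c]
        by (simp add: p_def q_def arity_def)
      also have "\<dots> = Fun (proper_symbols ar ! j)
          (map (term_of ar k') (tuple_of (arity j) (tuple_map (arity j) r z)))"
        using \<open>arity j > 0\<close> by (simp add: tuple_of_tuple_map r comp_def)
      also have "\<dots> = term_of ar k' (q' + (j + p * tuple_map (arity j) r z))"
        using term_of_app [OF j [unfolded p_def] ne(2)] by (simp add: p_def q'_def arity_def)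
      finally have "r c = q' + (j + p * tuple_map (arity j) r z)"
        using proper by (simp add: term_of_eq_iff [OF k(2)])
      also have "tuple_map (arity j) r z = tuple_map (arity j)
          (\<lambda>y. history_nth (rec_nat 0 (\<lambda>m h. prod_encode (r m, h)) c) (c - Suc y)) z"
        using \<open>z < c\<close> by (intro tuple_map_cong history_nth [symmetric]) simp
      finally show ?thesis
        using ge j by (simp add: G_def j_def z_def)
    qed
    from computable_course_of_values [OF G this] r that show thesis
      unfolding \<sigma>_def by blast
  qed
qed


section \<open>Quotients of term algebras\<close>

abbreviation (input) term_congruence :: "nat list \<Rightarrow> nat \<Rightarrow> (trm \<times> trm) set \<Rightarrow> bool" where
  "term_congruence ar k \<equiv> congruence ar (term_algebra ar k)"

lemma carrier_term_algebra: "carrier (term_algebra ar k) = terms ar {..<k}"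
  and op_term_algebra: "op (term_algebra ar k) = Fun"
  by (simp_all add: term_algebra_def)

lemma term_congruence_equiv: "term_congruence ar k \<theta> \<Longrightarrow> equiv (terms ar {..<k}) \<theta>"
  by (simp add: congruence_def carrier_term_algebra)

lemma term_congruence_subset: "term_congruence ar k \<theta> \<Longrightarrow> \<theta> \<subseteq> terms ar {..<k} \<times> terms ar {..<k}"
  using term_congruence_equiv by (metis equiv_def)

lemma term_congruence_refl: "term_congruence ar k \<theta> \<Longrightarrow> t \<in> terms ar {..<k} \<Longrightarrow> (t, t) \<in> \<theta>"
  using term_congruence_equiv by (metis equiv_def refl_onD)

lemma term_congruence_sym: "term_congruence ar k \<theta> \<Longrightarrow> (s, t) \<in> \<theta> \<Longrightarrow> (t, s) \<in> \<theta>"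
  using term_congruence_equiv by (metis equiv_def symD)

lemma term_congruence_trans:
  "term_congruence ar k \<theta> \<Longrightarrow> (s, t) \<in> \<theta> \<Longrightarrow> (t, u) \<in> \<theta> \<Longrightarrow> (s, u) \<in> \<theta>"
  using term_congruence_equiv by (metis equiv_def transD)

lemma term_congruence_Fun:
  "term_congruence ar k \<theta> \<Longrightarrow> f < length ar \<Longrightarrow> length ss = ar ! f \<Longrightarrow>
     list_all2 (\<lambda>s t. (s, t) \<in> \<theta>) ss ts \<Longrightarrow> (Fun f ss, Fun f ts) \<in> \<theta>"
  by (simp add: congruence_def op_term_algebra)

lemma term_congruenceI:
  assumes "\<theta> \<subseteq> terms ar {..<k} \<times> terms ar {..<k}"
    and "\<And>t. t \<in> terms ar {..<k} \<Longrightarrow> (t, t) \<in> \<theta>"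
    and "\<And>s t. (s, t) \<in> \<theta> \<Longrightarrow> (t, s) \<in> \<theta>"
    and "\<And>s t u. (s, t) \<in> \<theta> \<Longrightarrow> (t, u) \<in> \<theta> \<Longrightarrow> (s, u) \<in> \<theta>"
    and "\<And>f ss ts. f < length ar \<Longrightarrow> length ss = ar ! f \<Longrightarrow>
      list_all2 (\<lambda>s t. (s, t) \<in> \<theta>) ss ts \<Longrightarrow> (Fun f ss, Fun f ts) \<in> \<theta>"
  shows "term_congruence ar k \<theta>"
  unfolding congruence_def carrier_term_algebra op_term_algebra equiv_def
  by (intro conjI refl_onI symI transI allI impI) (fact assms | erule (2) assms | erule (1) assms | erule assms)+

lemma subst_in_terms:
  assumes "t \<in> terms ar X" "\<And>i. i \<in> X \<Longrightarrow> \<sigma> i \<in> terms ar Y"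
  shows "subst \<sigma> t \<in> terms ar Y"
  using assms(1) by induction (auto intro!: terms.app assms(2))

lemma terms_mono: "X \<subseteq> Y \<Longrightarrow> terms ar X \<subseteq> terms ar Y"
proof
  show "t \<in> terms ar Y" if "X \<subseteq> Y" "t \<in> terms ar X" for t
    using that(2,1) by induction (auto intro: terms.intros)
qed

lemma subst_subst: "subst \<sigma> (subst \<tau> t) = subst (\<lambda>i. subst \<sigma> (\<tau> i)) t"
  by (induction t) simp_all

lemma subst_cong_on: "t \<in> terms ar X \<Longrightarrow> (\<And>i. i \<in> X \<Longrightarrow> \<sigma> i = \<tau> i) \<Longrightarrow> subst \<sigma> t = subst \<tau> t"
  by (induction rule: terms.induct) auto

lemma subst_Var: "subst Var t = t"
  by (induction t) (simp_all add: map_idI)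

lemma term_congruence_full: "term_congruence ar k (terms ar {..<k} \<times> terms ar {..<k})"
proof (rule term_congruenceI)
  fix f ss ts
  assume f: "f < length ar" "length ss = ar ! f"
    and "list_all2 (\<lambda>s t. (s, t) \<in> terms ar {..<k} \<times> terms ar {..<k}) ss ts"
  then have "length ts = ar ! f" "set ss \<subseteq> terms ar {..<k}" "set ts \<subseteq> terms ar {..<k}"
    by (auto simp: list_all2_conv_all_nth in_set_conv_nth)
  with f show "(Fun f ss, Fun f ts) \<in> terms ar {..<k} \<times> terms ar {..<k}"
    by (auto intro!: terms.app)
qed auto

text \<open>For \<sigma> with values in the terms over j variables, this is the kernel of the
  homomorphism from the terms over k variables to the quotient by \<theta> that \<sigma>
  determines.\<close>

definition pullback :: "nat list \<Rightarrow> nat \<Rightarrow> (nat \<Rightarrow> trm) \<Rightarrow> (trm \<times> trm) set \<Rightarrow> (trm \<times> trm) set" where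
  "pullback ar k \<sigma> \<theta> =
     {(s, t). s \<in> terms ar {..<k} \<and> t \<in> terms ar {..<k} \<and> (subst \<sigma> s, subst \<sigma> t) \<in> \<theta>}"

lemma term_congruence_pullback:
  assumes \<theta>: "term_congruence ar j \<theta>" and \<sigma>: "\<And>i. i < k \<Longrightarrow> \<sigma> i \<in> terms ar {..<j}"
  shows "term_congruence ar k (pullback ar k \<sigma> \<theta>)"
proof (rule term_congruenceI)
  have *: "subst \<sigma> t \<in> terms ar {..<j}" if "t \<in> terms ar {..<k}" for t
    by (rule subst_in_terms [OF that]) (simp add: \<sigma>)
  show "pullback ar k \<sigma> \<theta> \<subseteq> terms ar {..<k} \<times> terms ar {..<k}"
    by (auto simp: pullback_def)
  show "(t, t) \<in> pullback ar k \<sigma> \<theta>" if "t \<in> terms ar {..<k}" for t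
    using that term_congruence_refl [OF \<theta> *] by (simp add: pullback_def)
  show "(t, s) \<in> pullback ar k \<sigma> \<theta>" if "(s, t) \<in> pullback ar k \<sigma> \<theta>" for s t
    using that term_congruence_sym [OF \<theta>] by (simp add: pullback_def)
  show "(s, u) \<in> pullback ar k \<sigma> \<theta>"
    if "(s, t) \<in> pullback ar k \<sigma> \<theta>" "(t, u) \<in> pullback ar k \<sigma> \<theta>" for s t u
    using that term_congruence_trans [OF \<theta>] by (simp add: pullback_def) blast
  fix f ss ts
  assume f: "f < length ar" "length ss = ar ! f"
    and r: "list_all2 (\<lambda>s t. (s, t) \<in> pullback ar k \<sigma> \<theta>) ss ts"
  then have "set ss \<subseteq> terms ar {..<k}" "set ts \<subseteq> terms ar {..<k}" "length ts = ar ! f"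
    by (auto simp: list_all2_conv_all_nth in_set_conv_nth pullback_def)
  moreover have "list_all2 (\<lambda>s t. (s, t) \<in> \<theta>) (map (subst \<sigma>) ss) (map (subst \<sigma>) ts)"
    using r by (auto simp: list_all2_conv_all_nth pullback_def)
  ultimately show "(Fun f ss, Fun f ts) \<in> pullback ar k \<sigma> \<theta>"
    using f term_congruence_Fun [OF \<theta> f(1), of "map (subst \<sigma>) ss" "map (subst \<sigma>) ts"]
    by (auto simp: pullback_def intro!: terms.app)
qed

text \<open>A substitution applied to an instance of a law yields another instance of the same
  law.\<close>

lemma law_instances_pullback:
  assumes \<theta>: "law_instances ar L j \<subseteq> \<theta>" and L: "L \<subseteq> terms ar UNIV \<times> terms ar UNIV"
    and \<sigma>: "\<And>i. i < k \<Longrightarrow> \<sigma> i \<in> terms ar {..<j}"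
  shows "law_instances ar L k \<subseteq> pullback ar k \<sigma> \<theta>"
proof
  fix x
  assume "x \<in> law_instances ar L k"
  then obtain s t \<tau> where x: "x = (subst \<tau> s, subst \<tau> t)" "(s, t) \<in> L"
      and \<tau>: "range \<tau> \<subseteq> terms ar {..<k}"
    by (auto simp: law_instances_def)
  have "range (\<lambda>i. subst \<sigma> (\<tau> i)) \<subseteq> terms ar {..<j}"
    using \<tau> by (auto intro!: subst_in_terms [where X = "{..<k}"] \<sigma>)
  then have "(subst (\<lambda>i. subst \<sigma> (\<tau> i)) s, subst (\<lambda>i. subst \<sigma> (\<tau> i)) t) \<in> law_instances ar L j"
    using x(2) unfolding law_instances_def by blast
  moreover have "s \<in> terms ar UNIV" "t \<in> terms ar UNIV"
    using x(2) L by auto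
  then have "subst \<tau> s \<in> terms ar {..<k}" "subst \<tau> t \<in> terms ar {..<k}"
    using \<tau> by (auto intro!: subst_in_terms [where X = UNIV])
  ultimately show "x \<in> pullback ar k \<sigma> \<theta>"
    using \<theta> by (auto simp: x pullback_def subst_subst)
qed

section \<open>Quotient algebras and their isomorphisms\<close>

abbreviation quotient_terms :: "nat list \<Rightarrow> nat \<Rightarrow> (trm \<times> trm) set \<Rightarrow> trm set algebra" where
  "quotient_terms ar k \<theta> \<equiv> quotient_algebra (term_algebra ar k) \<theta>"

lemma carrier_quotient_terms: "carrier (quotient_terms ar k \<theta>) = terms ar {..<k} // \<theta>"
  by (simp add: quotient_algebra_def carrier_term_algebra)

lemma listset_classes: "listset (map (\<lambda>a. \<theta> `` {a}) as) = {bs. list_all2 (\<lambda>a b. (a, b) \<in> \<theta>) as bs}"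
  by (induction as) (auto simp: set_Cons_def list_all2_Cons1)

lemma op_quotient_terms:
  assumes \<theta>: "term_congruence ar k \<theta>" and f: "f < length ar" "length ts = ar ! f"
    and ts: "set ts \<subseteq> terms ar {..<k}"
  shows "op (quotient_terms ar k \<theta>) f (map (\<lambda>t. \<theta> `` {t}) ts) = \<theta> `` {Fun f ts}"
proof -
  have "op (quotient_terms ar k \<theta>) f (map (\<lambda>t. \<theta> `` {t}) ts) =
      \<theta> `` (Fun f ` {us. list_all2 (\<lambda>a b. (a, b) \<in> \<theta>) ts us})"
    by (simp add: quotient_algebra_def op_term_algebra listset_classes)
  also have "\<dots> = \<theta> `` {Fun f ts}"
  proof -
    have "list_all2 (\<lambda>a b. (a, b) \<in> \<theta>) ts ts"
      using ts by (intro list.rel_refl_strong term_congruence_refl [OF \<theta>]) blast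
    moreover have "(Fun f ts, Fun f us) \<in> \<theta>" if "list_all2 (\<lambda>a b. (a, b) \<in> \<theta>) ts us" for us
      using term_congruence_Fun [OF \<theta> f that] .
    ultimately show ?thesis
      using term_congruence_trans [OF \<theta>] by blast
  qed
  finally show ?thesis .
qed

lemma quotient_terms_lists:
  assumes "set as \<subseteq> carrier (quotient_terms ar k \<theta>)"
  obtains ts where "as = map (\<lambda>t. \<theta> `` {t}) ts" "set ts \<subseteq> terms ar {..<k}"
proof -
  have "\<exists>ts. as = map (\<lambda>t. \<theta> `` {t}) ts \<and> set ts \<subseteq> terms ar {..<k}"
    using assms
  proof (induction as)
    case (Cons a as)
    then obtain ts t where "as = map (\<lambda>t. \<theta> `` {t}) ts" "set ts \<subseteq> terms ar {..<k}"
      "a = \<theta> `` {t}" "t \<in> terms ar {..<k}"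
      by (auto simp: carrier_quotient_terms elim: quotientE)
    then show ?case
      by (intro exI [of _ "t # ts"]) simp
  qed simp
  then show thesis
    using that by blast
qed

lemma class_eq_iff:
  assumes "term_congruence ar k \<theta>" "s \<in> terms ar {..<k}" "t \<in> terms ar {..<k}"
  shows "\<theta> `` {s} = \<theta> `` {t} \<longleftrightarrow> (s, t) \<in> \<theta>"
  using eq_equiv_class_iff [OF term_congruence_equiv [OF assms(1)] assms(2,3)] .

text \<open>A homomorphism between quotients of term algebras lifts to a substitution.\<close>

definition induces_iso ::
    "nat list \<Rightarrow> nat \<Rightarrow> (trm \<times> trm) set \<Rightarrow> nat \<Rightarrow> (trm \<times> trm) set \<Rightarrow> (nat \<Rightarrow> trm) \<Rightarrow> bool" where
  "induces_iso ar k \<theta> j \<theta>' \<sigma> \<longleftrightarrow>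
     (\<forall>i<k. \<sigma> i \<in> terms ar {..<j}) \<and> \<theta> = pullback ar k \<sigma> \<theta>' \<and>
     (\<forall>t\<in>terms ar {..<j}. \<exists>s\<in>terms ar {..<k}. (subst \<sigma> s, t) \<in> \<theta>')"

text \<open>Term algebras are free, so a homomorphism is determined by representatives of the images
  of the generators. Conversely, the kernel condition makes the induced map well defined and
  injective, and the last clause of \<open>induces_iso\<close> makes it surjective.\<close>

lemma isomorphic_quotient_terms_iff:
  assumes \<theta>: "term_congruence ar k \<theta>" and \<theta>': "term_congruence ar j \<theta>'"
  shows "isomorphic ar (quotient_terms ar k \<theta>) (quotient_terms ar j \<theta>') \<longleftrightarrow>
    (\<exists>\<sigma>. induces_iso ar k \<theta> j \<theta>' \<sigma>)"
proof
  assume "isomorphic ar (quotient_terms ar k \<theta>) (quotient_terms ar j \<theta>')"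
  then obtain \<phi> where bij: "bij_betw \<phi> (terms ar {..<k} // \<theta>) (terms ar {..<j} // \<theta>')"
    and hom: "\<And>f as. f < length ar \<Longrightarrow> length as = ar ! f \<Longrightarrow>
      set as \<subseteq> carrier (quotient_terms ar k \<theta>) \<Longrightarrow>
      \<phi> (op (quotient_terms ar k \<theta>) f as) = op (quotient_terms ar j \<theta>') f (map \<phi> as)"
    unfolding isomorphic_def carrier_quotient_terms by blast
  have "\<exists>u. u \<in> terms ar {..<j} \<and> \<phi> (\<theta> `` {Var i}) = \<theta>' `` {u}" if "i < k" for i
  proof -
    have "\<phi> (\<theta> `` {Var i}) \<in> terms ar {..<j} // \<theta>'"
      using that by (intro bij_betwE [OF bij, rule_format] quotientI terms.var) simp
    then show ?thesis
      by (auto elim: quotientE)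
  qed
  then obtain \<sigma> where \<sigma>: "\<And>i. i < k \<Longrightarrow> \<sigma> i \<in> terms ar {..<j}"
    and \<sigma>_eq: "\<And>i. i < k \<Longrightarrow> \<phi> (\<theta> `` {Var i}) = \<theta>' `` {\<sigma> i}"
    by metis
  have in_terms: "subst \<sigma> t \<in> terms ar {..<j}" if "t \<in> terms ar {..<k}" for t
    by (rule subst_in_terms [OF that]) (simp add: \<sigma>)
  have \<phi>: "\<phi> (\<theta> `` {t}) = \<theta>' `` {subst \<sigma> t}" if "t \<in> terms ar {..<k}" for t
    using that
  proof induction
    case (app f ts)
    then have ts: "set ts \<subseteq> terms ar {..<k}"
      by blast
    have "\<phi> (\<theta> `` {Fun f ts}) = \<phi> (op (quotient_terms ar k \<theta>) f (map (\<lambda>t. \<theta> `` {t}) ts))"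
      using op_quotient_terms [OF \<theta> app(1,2) ts] by simp
    also have "\<dots> = op (quotient_terms ar j \<theta>') f (map \<phi> (map (\<lambda>t. \<theta> `` {t}) ts))"
      using app(1,2) ts by (intro hom) (auto simp: carrier_quotient_terms intro: quotientI)
    also have "map \<phi> (map (\<lambda>t. \<theta> `` {t}) ts) = map (\<lambda>t. \<theta>' `` {t}) (map (subst \<sigma>) ts)"
      using app.IH by simp
    also have "op (quotient_terms ar j \<theta>') f \<dots> = \<theta>' `` {Fun f (map (subst \<sigma>) ts)}"
      using app(1,2) ts in_terms by (intro op_quotient_terms [OF \<theta>']) auto
    finally show ?case by simp
  qed (simp add: \<sigma>_eq)
  have "(s, t) \<in> \<theta> \<longleftrightarrow> (subst \<sigma> s, subst \<sigma> t) \<in> \<theta>'"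
    if st: "s \<in> terms ar {..<k}" "t \<in> terms ar {..<k}" for s t
  proof -
    have "(s, t) \<in> \<theta> \<longleftrightarrow> \<phi> (\<theta> `` {s}) = \<phi> (\<theta> `` {t})"
      using st class_eq_iff [OF \<theta> st] inj_on_eq_iff [OF bij_betw_imp_inj_on [OF bij]]
      by (simp add: quotientI)
    then show ?thesis
      using st \<phi> class_eq_iff [OF \<theta>' in_terms in_terms] by simp
  qed
  then have "\<theta> = pullback ar k \<sigma> \<theta>'"
    using term_congruence_subset [OF \<theta>] unfolding pullback_def by blast
  moreover have "\<exists>s\<in>terms ar {..<k}. (subst \<sigma> s, t) \<in> \<theta>'" if t: "t \<in> terms ar {..<j}" for t
  proof -
    obtain C where "C \<in> terms ar {..<k} // \<theta>" "\<phi> C = \<theta>' `` {t}"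
      using bij_betw_imp_surj_on [OF bij] quotientI [OF t] by (metis imageE)
    then obtain s where "s \<in> terms ar {..<k}" "\<phi> (\<theta> `` {s}) = \<theta>' `` {t}"
      by (metis quotientE)
    then show ?thesis
      using \<phi> class_eq_iff [OF \<theta>' in_terms t] by metis
  qed
  ultimately show "\<exists>\<sigma>. induces_iso ar k \<theta> j \<theta>' \<sigma>"
    using \<sigma> unfolding induces_iso_def by blast
next
  assume "\<exists>\<sigma>. induces_iso ar k \<theta> j \<theta>' \<sigma>"
  then obtain \<sigma> where \<sigma>: "\<And>i. i < k \<Longrightarrow> \<sigma> i \<in> terms ar {..<j}"
    and eq: "\<theta> = pullback ar k \<sigma> \<theta>'"
    and surj: "\<And>t. t \<in> terms ar {..<j} \<Longrightarrow> \<exists>s\<in>terms ar {..<k}. (subst \<sigma> s, t) \<in> \<theta>'"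
    unfolding induces_iso_def by blast
  have in_terms: "subst \<sigma> t \<in> terms ar {..<j}" if "t \<in> terms ar {..<k}" for t
    by (rule subst_in_terms [OF that]) (simp add: \<sigma>)
  \<comment> \<open>Taking the image of the entire class avoids a choice of representatives; closing
    it under \<theta>' gives a single class.\<close>
  define \<phi> where "\<phi> C = \<theta>' `` (subst \<sigma> ` C)" for C
  have \<phi>: "\<phi> (\<theta> `` {t}) = \<theta>' `` {subst \<sigma> t}" if t: "t \<in> terms ar {..<k}" for t
  proof -
    have "subst \<sigma> t \<in> subst \<sigma> ` (\<theta> `` {t})"
      using term_congruence_refl [OF \<theta> t] by blast
    moreover have "(subst \<sigma> t, u) \<in> \<theta>'" if "u \<in> subst \<sigma> ` (\<theta> `` {t})" for u
      using that unfolding eq pullback_def by auto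
    ultimately show ?thesis
      unfolding \<phi>_def using term_congruence_trans [OF \<theta>'] by blast
  qed
  have iff: "(s, t) \<in> \<theta> \<longleftrightarrow> (subst \<sigma> s, subst \<sigma> t) \<in> \<theta>'"
    if "s \<in> terms ar {..<k}" "t \<in> terms ar {..<k}" for s t
    using that by (simp add: eq pullback_def)
  have "bij_betw \<phi> (terms ar {..<k} // \<theta>) (terms ar {..<j} // \<theta>')"
    unfolding bij_betw_def
  proof
    show "inj_on \<phi> (terms ar {..<k} // \<theta>)"
    proof (rule inj_onI)
      fix C D
      assume CD: "C \<in> terms ar {..<k} // \<theta>" "D \<in> terms ar {..<k} // \<theta>" "\<phi> C = \<phi> D"
      then obtain s t where st: "C = \<theta> `` {s}" "D = \<theta> `` {t}" "s \<in> terms ar {..<k}" "t \<in> terms ar {..<k}"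
        by (metis quotientE)
      then have "(subst \<sigma> s, subst \<sigma> t) \<in> \<theta>'"
        using CD(3) \<phi> class_eq_iff [OF \<theta>' in_terms in_terms] by metis
      then show "C = D"
        using st iff class_eq_iff [OF \<theta>] by metis
    qed
    show "\<phi> ` (terms ar {..<k} // \<theta>) = terms ar {..<j} // \<theta>'"
    proof (intro equalityI subsetI)
      fix D
      assume "D \<in> \<phi> ` (terms ar {..<k} // \<theta>)"
      then obtain s where "s \<in> terms ar {..<k}" "D = \<phi> (\<theta> `` {s})"
        by (auto elim: quotientE)
      then show "D \<in> terms ar {..<j} // \<theta>'"
        using \<phi> in_terms by (simp add: quotientI)
    next
      fix D
      assume "D \<in> terms ar {..<j} // \<theta>'"
      then obtain t where t: "t \<in> terms ar {..<j}" "D = \<theta>' `` {t}"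
        by (metis quotientE)
      then obtain s where s: "s \<in> terms ar {..<k}" "(subst \<sigma> s, t) \<in> \<theta>'"
        using surj by blast
      then have "D = \<phi> (\<theta> `` {s})"
        using t \<phi> class_eq_iff [OF \<theta>' in_terms t(1)] by metis
      then show "D \<in> \<phi> ` (terms ar {..<k} // \<theta>)"
        using s(1) by (simp add: quotientI)
    qed
  qed
  moreover have "\<phi> (op (quotient_terms ar k \<theta>) f as) = op (quotient_terms ar j \<theta>') f (map \<phi> as)"
    if f: "f < length ar" "length as = ar ! f" and as: "set as \<subseteq> carrier (quotient_terms ar k \<theta>)"
    for f as
  proof -
    obtain ts where ts: "as = map (\<lambda>t. \<theta> `` {t}) ts" "set ts \<subseteq> terms ar {..<k}"
      using quotient_terms_lists [OF as] .
    have len: "length ts = ar ! f"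
      using f(2) ts(1) by simp
    have "\<phi> (op (quotient_terms ar k \<theta>) f as) = \<phi> (\<theta> `` {Fun f ts})"
      unfolding ts(1) op_quotient_terms [OF \<theta> f(1) len ts(2)] ..
    also have "\<dots> = \<theta>' `` {Fun f (map (subst \<sigma>) ts)}"
      using f(1) len ts(2) by (subst \<phi>) (auto intro!: terms.app)
    also have "\<dots> = op (quotient_terms ar j \<theta>') f (map (\<lambda>t. \<theta>' `` {t}) (map (subst \<sigma>) ts))"
      using f(1) len ts(2) in_terms by (intro op_quotient_terms [OF \<theta>', symmetric]) auto
    also have "map (\<lambda>t. \<theta>' `` {t}) (map (subst \<sigma>) ts) = map \<phi> as"
      using ts \<phi> by auto
    finally show ?thesis .
  qed
  ultimately show "isomorphic ar (quotient_terms ar k \<theta>) (quotient_terms ar j \<theta>')"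
    unfolding isomorphic_def carrier_quotient_terms by blast
qed

section \<open>Isomorphism as an equivalence relation\<close>

lemma isomorphic_refl: "isomorphic ar A A"
  unfolding isomorphic_def by (rule exI [of _ id]) simp

lemma isomorphic_trans:
  assumes "isomorphic ar A B" "isomorphic ar B C"
  shows "isomorphic ar A C"
proof -
  obtain \<phi> where \<phi>: "bij_betw \<phi> (carrier A) (carrier B)"
    "\<forall>f<length ar. \<forall>as. length as = ar ! f \<longrightarrow> set as \<subseteq> carrier A \<longrightarrow>
           \<phi> (op A f as) = op B f (map \<phi> as)"
    using assms(1) unfolding isomorphic_def by blast
  obtain \<psi> where \<psi>: "bij_betw \<psi> (carrier B) (carrier C)"
    "\<forall>f<length ar. \<forall>as. length as = ar ! f \<longrightarrow> set as \<subseteq> carrier B \<longrightarrow>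
           \<psi> (op B f as) = op C f (map \<psi> as)"
    using assms(2) unfolding isomorphic_def by blast
  have "(\<psi> \<circ> \<phi>) (op A f as) = op C f (map (\<psi> \<circ> \<phi>) as)"
    if "f < length ar" "length as = ar ! f" "set as \<subseteq> carrier A" for f as
  proof -
    have "set (map \<phi> as) \<subseteq> carrier B"
      using that(3) bij_betw_imp_surj_on [OF \<phi>(1)] by auto
    then show ?thesis
      using that \<phi>(2) \<psi>(2) by simp
  qed
  then show ?thesis
    unfolding isomorphic_def using bij_betw_trans [OF \<phi>(1) \<psi>(1)] by blast
qed

text \<open>The record type does not force operations to stay in the carrier. Closure of A is
  assumed because the inverse map undoes \<phi> on the carrier only.\<close>

lemma isomorphic_sym:
  assumes "isomorphic ar A B"
    and closed: "\<And>f as. f < length ar \<Longrightarrow> length as = ar ! f \<Longrightarrow> set as \<subseteq> carrier A \<Longrightarrow>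
      op A f as \<in> carrier A"
  shows "isomorphic ar B A"
proof -
  obtain \<phi> where \<phi>: "bij_betw \<phi> (carrier A) (carrier B)"
    "\<forall>f<length ar. \<forall>as. length as = ar ! f \<longrightarrow> set as \<subseteq> carrier A \<longrightarrow>
           \<phi> (op A f as) = op B f (map \<phi> as)"
    using assms(1) unfolding isomorphic_def by blast
  define \<psi> where "\<psi> = inv_into (carrier A) \<phi>"
  have \<psi>: "bij_betw \<psi> (carrier B) (carrier A)"
    unfolding \<psi>_def by (rule bij_betw_inv_into [OF \<phi>(1)])
  have "\<psi> (op B f bs) = op A f (map \<psi> bs)"
    if f: "f < length ar" "length bs = ar ! f" and bs: "set bs \<subseteq> carrier B" for f bs
  proof -
    have as: "set (map \<psi> bs) \<subseteq> carrier A"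
      using bs bij_betw_imp_surj_on [OF \<psi>] by auto
    have "map \<phi> (map \<psi> bs) = bs"
      using bs bij_betw_inv_into_right [OF \<phi>(1)] by (auto simp: \<psi>_def intro!: map_idI)
    then have "op B f bs = \<phi> (op A f (map \<psi> bs))"
      using \<phi>(2) f as by simp
    then show ?thesis
      using bij_betw_inv_into_left [OF \<phi>(1)] closed [OF f(1) _ as] f(2) by (simp add: \<psi>_def)
  qed
  with \<psi> show ?thesis
    unfolding isomorphic_def by blast
qed

lemma isomorphic_quotient_terms_sym:
  assumes \<theta>: "term_congruence ar k \<theta>" and "isomorphic ar (quotient_terms ar k \<theta>) B"
  shows "isomorphic ar B (quotient_terms ar k \<theta>)"
  using assms(2)
proof (rule isomorphic_sym)
  fix f as
  assume f: "f < length ar" "length as = ar ! f" "set as \<subseteq> carrier (quotient_terms ar k \<theta>)"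
  then obtain ts where ts: "as = map (\<lambda>t. \<theta> `` {t}) ts" "set ts \<subseteq> terms ar {..<k}"
    using quotient_terms_lists by metis
  then have "op (quotient_terms ar k \<theta>) f as = \<theta> `` {Fun f ts}"
    using f op_quotient_terms [OF \<theta> f(1) _ ts(2)] by simp
  moreover have "Fun f ts \<in> terms ar {..<k}"
    using f ts by (auto intro!: terms.app)
  ultimately show "op (quotient_terms ar k \<theta>) f as \<in> carrier (quotient_terms ar k \<theta>)"
    by (simp add: carrier_quotient_terms quotientI)
qed


section \<open>Presentations\<close>

definition presented_congruence ::
    "nat list \<Rightarrow> (trm \<times> trm) set \<Rightarrow> nat \<Rightarrow> (trm \<times> trm) set \<Rightarrow> (trm \<times> trm) set" where
  "presented_congruence ar L k S =
     \<Inter>{\<theta>. term_congruence ar k \<theta> \<and> S \<union> law_instances ar L k \<subseteq> \<theta>}"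

lemma presented_eq: "presented ar L k S = quotient_terms ar k (presented_congruence ar L k S)"
  by (simp add: presented_def presented_congruence_def)

lemma subset_presented_congruence: "S \<subseteq> presented_congruence ar L k S"
  and law_instances_subset: "law_instances ar L k \<subseteq> presented_congruence ar L k S"
  unfolding presented_congruence_def by blast+

lemma presented_congruence_least:
  "term_congruence ar k \<theta> \<Longrightarrow> S \<subseteq> \<theta> \<Longrightarrow> law_instances ar L k \<subseteq> \<theta> \<Longrightarrow>
     presented_congruence ar L k S \<subseteq> \<theta>"
  unfolding presented_congruence_def by blast

lemma presented_congruence_mono:
  "S \<subseteq> S' \<Longrightarrow> presented_congruence ar L k S \<subseteq> presented_congruence ar L k S'"
  unfolding presented_congruence_def by blast

locale laws =
  fixes ar :: "nat list" and L :: "(trm \<times> trm) set"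
  assumes laws: "L \<subseteq> terms ar UNIV \<times> terms ar UNIV"
begin

abbreviation T :: "nat \<Rightarrow> trm set" where "T k \<equiv> terms ar {..<k}"
abbreviation con :: "nat \<Rightarrow> (trm \<times> trm) set \<Rightarrow> (trm \<times> trm) set" where
  "con \<equiv> presented_congruence ar L"

lemma law_instances_terms: "law_instances ar L k \<subseteq> T k \<times> T k"
  using laws unfolding law_instances_def by (fastforce intro: subst_in_terms)

text \<open>All closure properties pass to intersections. The full relation is one of the
  congruences intersected, which confines the result to terms over k variables.\<close>

lemma term_congruence_con:
  assumes "S \<subseteq> T k \<times> T k"
  shows "term_congruence ar k (con k S)"
proof (rule term_congruenceI)
  show "con k S \<subseteq> T k \<times> T k"
    using assms by (intro presented_congruence_least term_congruence_full law_instances_terms)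
  show "(t, t) \<in> con k S" if "t \<in> T k" for t
    using that term_congruence_refl unfolding presented_congruence_def by blast
  show "(t, s) \<in> con k S" if "(s, t) \<in> con k S" for s t
    using that term_congruence_sym unfolding presented_congruence_def by blast
  show "(s, u) \<in> con k S" if "(s, t) \<in> con k S" "(t, u) \<in> con k S" for s t u
    using that term_congruence_trans unfolding presented_congruence_def by blast
  fix f ss ts
  assume f: "f < length ar" "length ss = ar ! f" and r: "list_all2 (\<lambda>s t. (s, t) \<in> con k S) ss ts"
  show "(Fun f ss, Fun f ts) \<in> con k S"
    unfolding presented_congruence_def
  proof (intro InterI, elim CollectE conjE)
    fix \<theta>
    assume \<theta>: "term_congruence ar k \<theta>" "S \<union> law_instances ar L k \<subseteq> \<theta>"
    then have "con k S \<subseteq> \<theta>"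
      by (intro presented_congruence_least) auto
    then have "list_all2 (\<lambda>s t. (s, t) \<in> \<theta>) ss ts"
      using r by (auto elim: list_all2_mono)
    then show "(Fun f ss, Fun f ts) \<in> \<theta>"
      using term_congruence_Fun [OF \<theta>(1) f] by blast
  qed
qed

text \<open>Von Dyck's principle: a substitution that respects the defining relations induces a
  homomorphism of the presented algebras. The laws are respected automatically.\<close>

lemma con_pullback:
  assumes "S' \<subseteq> T j \<times> T j" "\<And>i. i < k \<Longrightarrow> \<sigma> i \<in> T j" "S \<subseteq> pullback ar k \<sigma> (con j S')"
  shows "con k S \<subseteq> pullback ar k \<sigma> (con j S')"
  by (rule presented_congruence_least
      [OF term_congruence_pullback [OF term_congruence_con [OF assms(1)] assms(2)] assms(3)
        law_instances_pullback [OF law_instances_subset laws assms(2)]])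

lemma pair_of_terms: "k \<ge> 1 \<Longrightarrow> pair_of ar k ` A \<subseteq> T k \<times> T k"
  using range_term_of [of k ar] by (auto simp: pair_of_def map_prod_def split: prod.splits)

lemma surj_pair_of:
  assumes "k \<ge> 1" "x \<in> T k \<times> T k"
  obtains c where "pair_of ar k c = x"
proof -
  obtain a b where "term_of ar k a = fst x" "term_of ar k b = snd x"
    using assms range_term_of [of k ar] by (metis imageE mem_Times_iff)
  then have "pair_of ar k (prod_encode (a, b)) = x"
    by (simp add: pair_of_def)
  then show thesis ..
qed

section \<open>Adding a redundant generator\<close>

definition collapse :: "nat \<Rightarrow> nat \<Rightarrow> trm" where
  "collapse n i = Var (if i = n then 0 else i)"

text \<open>The number \<^term>\<open>prod_encode (n, 0)\<close> codes the pair \<open>(x\<^sub>n, x\<^sub>0)\<close>.\<close>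

definition lift :: "nat \<Rightarrow> nat set \<Rightarrow> nat set" where
  "lift n A = {c. c = prod_encode (n, 0) \<or>
     (\<exists>c'\<in>A. pair_of ar n c' = map_prod (subst (collapse n)) (subst (collapse n)) (pair_of ar (n + 1) c))}"

lemma pair_of_generators: "pair_of ar (n + 1) (prod_encode (n, 0)) = (Var n, Var 0)"
  by (simp add: pair_of_def term_of_atom atoms_def nth_append)

lemma collapse_in_terms: "n \<ge> 1 \<Longrightarrow> i < n + 1 \<Longrightarrow> collapse n i \<in> T n"
  by (auto simp: collapse_def intro!: terms.var)

lemma subst_collapse_id: "t \<in> T n \<Longrightarrow> subst (collapse n) t = t"
  using subst_cong_on [of t ar "{..<n}" "collapse n" Var] subst_Var [of t]
  by (simp add: collapse_def)

text \<open>The collapse is a retraction onto the terms without x_n. It sends the lifted relations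
  to consequences of A, and conversely the lifted relations contain those of A and make each term
  equal to its collapse.\<close>

lemma con_lift:
  assumes n: "n \<ge> 1"
  shows "con (n + 1) (pair_of ar (n + 1) ` lift n A) =
    pullback ar (n + 1) (collapse n) (con n (pair_of ar n ` A))" (is "?C' = pullback ar _ _ ?C")
proof
  have S: "pair_of ar n ` A \<subseteq> T n \<times> T n" "pair_of ar (n + 1) ` lift n A \<subseteq> T (n + 1) \<times> T (n + 1)"
    using pair_of_terms n by simp_all
  note C = S [THEN term_congruence_con]
  show "?C' \<subseteq> pullback ar (n + 1) (collapse n) ?C"
  proof (rule con_pullback [OF S(1) collapse_in_terms [OF n]])
    show "pair_of ar (n + 1) ` lift n A \<subseteq> pullback ar (n + 1) (collapse n) ?C"
    proof (rule image_subsetI)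
      fix c
      assume c: "c \<in> lift n A"
      obtain s t where st: "pair_of ar (n + 1) c = (s, t)" "s \<in> T (n + 1)" "t \<in> T (n + 1)"
        using pair_of_terms [of "n + 1" "{c}"] by force
      have "(subst (collapse n) s, subst (collapse n) t) \<in> ?C"
      proof (cases "c = prod_encode (n, 0)")
        case True
        then have "s = Var n" "t = Var 0"
          using st(1) pair_of_generators by simp_all
        moreover have "(Var 0, Var 0) \<in> ?C"
          using n by (intro term_congruence_refl [OF C(1)] terms.var) simp
        ultimately show ?thesis
          by (simp add: collapse_def)
      next
        case False
        then have "(subst (collapse n) s, subst (collapse n) t) \<in> pair_of ar n ` A"
          using c st(1) by (force simp: lift_def)
        then show ?thesis
          using subset_presented_congruence by blast
      qed
      then show "pair_of ar (n + 1) c \<in> pullback ar (n + 1) (collapse n) ?C"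
        using st by (simp add: pullback_def)
    qed
  qed
  \<comment> \<open>Pairs over n variables are fixed by the collapse, so the relations coded by A
    occur among the lifted ones. The inclusion of generators then induces a homomorphism.\<close>
  have sub: "?C \<subseteq> ?C'"
  proof -
    have "?C \<subseteq> pullback ar n Var ?C'"
    proof (rule con_pullback [OF S(2)])
      show "pair_of ar n ` A \<subseteq> pullback ar n Var ?C'"
      proof (rule image_subsetI)
        fix c'
        assume c': "c' \<in> A"
        obtain s t where st: "pair_of ar n c' = (s, t)" "s \<in> T n" "t \<in> T n"
          using pair_of_terms [OF n, of "{c'}"] by force
        have "(s, t) \<in> T (n + 1) \<times> T (n + 1)"
          using st terms_mono [of "{..<n}" "{..<n + 1}"] by auto
        then obtain c where "pair_of ar (n + 1) c = (s, t)"
          using surj_pair_of [of "n + 1"] by auto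
        then have "c \<in> lift n A"
          using c' st by (auto simp: lift_def subst_collapse_id intro: bexI [of _ c'])
        then have "(s, t) \<in> ?C'"
          using subset_presented_congruence \<open>pair_of ar (n + 1) c = (s, t)\<close> by (metis image_eqI subsetD)
        then show "pair_of ar n c' \<in> pullback ar n Var ?C'"
          by (simp add: st pullback_def subst_Var)
      qed
    qed (auto intro: terms.var)
    then show ?thesis
      by (auto simp: pullback_def subst_Var)
  qed
  have collapse: "(t, subst (collapse n) t) \<in> ?C'" if "t \<in> T (n + 1)" for t
    using that
  proof induction
    case (var i)
    have "prod_encode (n, 0) \<in> lift n A"
      by (simp add: lift_def)
    then have "(Var n, Var 0) \<in> ?C'"
      using subset_presented_congruence pair_of_generators by (metis image_eqI subsetD)
    moreover have "(Var i, Var i) \<in> ?C'"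
      using var by (intro term_congruence_refl [OF C(2)] terms.var)
    ultimately show ?case
      by (simp add: collapse_def)
  next
    case (app f ts)
    then have "list_all2 (\<lambda>s t. (s, t) \<in> ?C') ts (map (subst (collapse n)) ts)"
      by (auto simp: list_all2_conv_all_nth)
    then show ?case
      using term_congruence_Fun [OF C(2) app(1,2)] by simp
  qed
  show "pullback ar (n + 1) (collapse n) ?C \<subseteq> ?C'"
  proof clarify
    fix s t
    assume "(s, t) \<in> pullback ar (n + 1) (collapse n) ?C"
    then have "s \<in> T (n + 1)" "t \<in> T (n + 1)" "(subst (collapse n) s, subst (collapse n) t) \<in> ?C'"
      using sub by (auto simp: pullback_def)
    then show "(s, t) \<in> ?C'"
      using collapse term_congruence_trans [OF C(2)] term_congruence_sym [OF C(2)] by meson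
  qed
qed

lemma isomorphic_lift:
  assumes n: "n \<ge> 1"
  shows "isomorphic ar (presented ar L (n + 1) (pair_of ar (n + 1) ` lift n A))
    (presented ar L n (pair_of ar n ` A))"
proof -
  have S: "pair_of ar n ` A \<subseteq> T n \<times> T n" "pair_of ar (n + 1) ` lift n A \<subseteq> T (n + 1) \<times> T (n + 1)"
    using pair_of_terms n by simp_all
  note C = S [THEN term_congruence_con]
  have "\<exists>s\<in>T (n + 1). (subst (collapse n) s, t) \<in> con n (pair_of ar n ` A)" if t: "t \<in> T n" for t
    using subst_collapse_id [OF t] term_congruence_refl [OF C(1) t] t terms_mono [of "{..<n}" "{..<n + 1}"]
    by (intro bexI [of _ t]) auto
  then have "induces_iso ar (n + 1) (con (n + 1) (pair_of ar (n + 1) ` lift n A)) n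
      (con n (pair_of ar n ` A)) (collapse n)"
    unfolding induces_iso_def using con_lift [OF n] collapse_in_terms [OF n] by blast
  then show ?thesis
    unfolding presented_eq isomorphic_quotient_terms_iff [OF C(2,1)] by blast
qed

lemma isomorphic_presented_sym:
  assumes "S \<subseteq> T k \<times> T k" "isomorphic ar (presented ar L k S) B"
  shows "isomorphic ar B (presented ar L k S)"
  using isomorphic_quotient_terms_sym [OF term_congruence_con [OF assms(1)]] assms(2)
  unfolding presented_eq .

lemma isomorphic_lift_iff:
  assumes n: "n \<ge> 1"
  shows "isomorphic ar (presented ar L (n + 1) (pair_of ar (n + 1) ` lift n A))
      (presented ar L (n + 1) (pair_of ar (n + 1) ` lift n B)) \<longleftrightarrow>
    isomorphic ar (presented ar L n (pair_of ar n ` A)) (presented ar L n (pair_of ar n ` B))"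
    (is "isomorphic ar (?P' A) (?P' B) \<longleftrightarrow> isomorphic ar (?P A) (?P B)")
proof -
  have down: "isomorphic ar (?P' A) (?P A)" for A
    by (rule isomorphic_lift [OF n])
  have up: "isomorphic ar (?P A) (?P' A)" for A
    using n by (intro isomorphic_presented_sym [OF pair_of_terms down]) simp
  show ?thesis
  proof
    assume "isomorphic ar (?P' A) (?P' B)"
    from isomorphic_trans [OF isomorphic_trans [OF up this] down]
    show "isomorphic ar (?P A) (?P B)" .
  next
    assume "isomorphic ar (?P A) (?P B)"
    from isomorphic_trans [OF isomorphic_trans [OF down this] up]
    show "isomorphic ar (?P' A) (?P' B)" .
  qed
qed

text \<open>Two distinct free generators can be sent to arbitrary elements of any algebra
  considered, so if they are equal, all elements are. That they are distinct uses n > 0.\<close>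

lemma trivial_if_generators_identified:
  assumes n: "n \<ge> 1" and "(Var n, Var 0) \<in> con (n + 1) {}"
  shows "\<not> nontrivial ar L"
proof -
  have "a = b" if k: "k \<ge> 1" and ab: "a \<in> carrier (indexed_algebra ar L k e)"
    "b \<in> carrier (indexed_algebra ar L k e)" for k e a b
  proof -
    let ?C = "con k (pair_of ar k ` W e)"
    have S: "pair_of ar k ` W e \<subseteq> T k \<times> T k"
      by (rule pair_of_terms [OF k])
    obtain s t where st: "a = ?C `` {s}" "s \<in> T k" "b = ?C `` {t}" "t \<in> T k"
      using ab unfolding indexed_algebra_def presented_eq carrier_quotient_terms
      by (metis quotientE)
    define \<sigma> where "\<sigma> i = (if i = n then s else t)" for i
    have "con (n + 1) {} \<subseteq> pullback ar (n + 1) \<sigma> ?C"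
      by (rule con_pullback [OF S]) (auto simp: \<sigma>_def st)
    then have "(s, t) \<in> ?C"
      using assms by (auto simp: pullback_def \<sigma>_def)
    then show "a = b"
      using st class_eq_iff [OF term_congruence_con [OF S]] by metis
  qed
  then show ?thesis
    unfolding nontrivial_def fg_algebras_def by blast
qed

end

section \<open>Consequences of the ascending chain condition\<close>

locale noetherian_laws = laws +
  assumes acc: "ascending_chain_condition ar L"
begin

text \<open>By the correspondence theorem, congruences on terms that contain the law instances are
  congruences of the free algebra on k generators, to which the chain condition applies.\<close>

lemma term_congruence_chain:
  assumes k: "k \<ge> 1" and \<theta>: "\<And>i. term_congruence ar k (\<theta> i)" and laws: "con k {} \<subseteq> \<theta> 0"
    and Suc: "\<And>i. \<theta> i \<subseteq> \<theta> (Suc i)"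
  obtains N where "\<And>i. i \<ge> N \<Longrightarrow> \<theta> i = \<theta> N"
proof -
  define \<rho> where "\<rho> = con k {}"
  have \<rho>: "term_congruence ar k \<rho>"
    unfolding \<rho>_def by (rule term_congruence_con) simp
  \<comment> \<open>An index of the empty set exhibits the free algebra as a member of
    \<open>fg_algebras\<close>.\<close>
  have "\<exists>e. W e = {}"
    by (rule semidecidable_index [of "\<lambda>_ _. False", OF decidable_const], rule exI, simp)
  then obtain e where "W e = {}" ..
  then have "indexed_algebra ar L k e = quotient_terms ar k \<rho>"
    by (simp add: indexed_algebra_def presented_eq \<rho>_def)
  then have fg: "quotient_terms ar k \<rho> \<in> fg_algebras ar L"
    using k unfolding fg_algebras_def by (intro CollectI exI [of _ k] exI [of _ e]) simp
  have sub: "\<rho> \<subseteq> \<theta> i" for i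
    by (induction i) (use laws Suc in \<open>auto simp: \<rho>_def\<close>)
  define \<theta>' where "\<theta>' i = {(\<rho> `` {s}, \<rho> `` {t}) | s t. (s, t) \<in> \<theta> i}" for i
  \<comment> \<open>Since \<theta> i contains \<rho>, membership does not depend on the
    representatives.\<close>
  have iff: "(\<rho> `` {s}, \<rho> `` {t}) \<in> \<theta>' i \<longleftrightarrow> (s, t) \<in> \<theta> i" if "s \<in> T k" "t \<in> T k" for s t i
  proof
    assume "(\<rho> `` {s}, \<rho> `` {t}) \<in> \<theta>' i"
    then obtain s' t' where st: "\<rho> `` {s} = \<rho> `` {s'}" "\<rho> `` {t} = \<rho> `` {t'}" "(s', t') \<in> \<theta> i"
      unfolding \<theta>'_def by blast
    then have "s' \<in> T k" "t' \<in> T k"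
      using term_congruence_subset [OF \<theta>] by auto
    then have "(s, s') \<in> \<theta> i" "(t, t') \<in> \<theta> i"
      using st that class_eq_iff [OF \<rho>] sub by blast+
    then show "(s, t) \<in> \<theta> i"
      using st(3) term_congruence_trans [OF \<theta>] term_congruence_sym [OF \<theta>] by blast
  qed (auto simp: \<theta>'_def)
  have "congruence ar (quotient_terms ar k \<rho>) (\<theta>' i)" for i
  proof -
    have in_iff: "(a, b) \<in> \<theta>' i \<longleftrightarrow>
        (\<exists>s t. a = \<rho> `` {s} \<and> b = \<rho> `` {t} \<and> (s, t) \<in> \<theta> i \<and> s \<in> T k \<and> t \<in> T k)" for a b
      using term_congruence_subset [OF \<theta>] unfolding \<theta>'_def by blast
    have sub': "\<theta>' i \<subseteq> T k // \<rho> \<times> T k // \<rho>"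
      by (auto simp: in_iff quotientI)
    have "equiv (T k // \<rho>) (\<theta>' i)"
    proof (rule equivI)
      show "\<theta>' i \<subseteq> T k // \<rho> \<times> T k // \<rho>"
        by (rule sub')
      show "refl_on (T k // \<rho>) (\<theta>' i)"
        by (rule refl_onI) (metis quotientE iff term_congruence_refl [OF \<theta>])
      show "sym (\<theta>' i)"
        by (rule symI) (metis in_iff term_congruence_sym [OF \<theta>])
      show "trans (\<theta>' i)"
      proof (rule transI)
        fix a b c
        assume "(a, b) \<in> \<theta>' i" "(b, c) \<in> \<theta>' i"
        then obtain s t u where "a = \<rho> `` {s}" "b = \<rho> `` {t}" "c = \<rho> `` {u}"
          "s \<in> T k" "t \<in> T k" "u \<in> T k"
          unfolding in_iff by blast
        then show "(a, c) \<in> \<theta>' i"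
          using \<open>(a, b) \<in> \<theta>' i\<close> \<open>(b, c) \<in> \<theta>' i\<close> iff term_congruence_trans [OF \<theta>] by metis
      qed
    qed
    moreover have "(op (quotient_terms ar k \<rho>) f as, op (quotient_terms ar k \<rho>) f bs) \<in> \<theta>' i"
      if f: "f < length ar" "length as = ar ! f" and r: "list_all2 (\<lambda>a b. (a, b) \<in> \<theta>' i) as bs"
      for f as bs
    proof -
      have "list_all2 (\<lambda>a b. a \<in> T k // \<rho> \<and> b \<in> T k // \<rho>) as bs"
        using r by (rule list_all2_mono) (use sub' in blast)
      then have "set as \<subseteq> carrier (quotient_terms ar k \<rho>)" "set bs \<subseteq> carrier (quotient_terms ar k \<rho>)"
        by (auto simp: list_all2_conv_all_nth in_set_conv_nth carrier_quotient_terms)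
      then obtain ss ts where st: "as = map (\<lambda>t. \<rho> `` {t}) ss" "set ss \<subseteq> T k"
        "bs = map (\<lambda>t. \<rho> `` {t}) ts" "set ts \<subseteq> T k"
        by (metis quotient_terms_lists)
      have len: "length ss = ar ! f" "length ts = ar ! f"
        using f(2) r st by (auto dest: list_all2_lengthD)
      have "list_all2 (\<lambda>s t. (s, t) \<in> \<theta> i) ss ts"
        using r st iff by (auto simp: list_all2_conv_all_nth subset_iff)
      then have "(Fun f ss, Fun f ts) \<in> \<theta> i"
        by (rule term_congruence_Fun [OF \<theta> f(1) len(1)])
      then show ?thesis
        unfolding st(1,3) op_quotient_terms [OF \<rho> f(1) len(1) st(2)]
          op_quotient_terms [OF \<rho> f(1) len(2) st(4)] \<theta>'_def by blast
    qed
    ultimately show ?thesis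
      unfolding congruence_def carrier_quotient_terms by blast
  qed
  moreover have "\<theta>' i \<subseteq> \<theta>' (Suc i)" for i
    using Suc unfolding \<theta>'_def by blast
  ultimately obtain N where N: "\<forall>i\<ge>N. \<theta>' i = \<theta>' N"
    using acc fg unfolding ascending_chain_condition_def by blast
  have "\<theta> i = \<theta> N" if "i \<ge> N" for i
  proof -
    have "(s, t) \<in> \<theta> i \<longleftrightarrow> (s, t) \<in> \<theta> N" if "s \<in> T k" "t \<in> T k" for s t
      using iff [OF that] N \<open>i \<ge> N\<close> by metis
    then show ?thesis
      using term_congruence_subset [OF \<theta>] by blast
  qed
  then show thesis
    using that by blast
qed

text \<open>The preimages of \<open>\<theta>\<close> under the powers of \<open>\<sigma>\<close> form an ascending chain.\<close>

lemma hopfian: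
  assumes k: "k \<ge> 1" and S: "S \<subseteq> T k \<times> T k" "S' \<subseteq> T k \<times> T k" and sub: "con k S \<subseteq> con k S'"
    and iso: "isomorphic ar (presented ar L k S) (presented ar L k S')"
  shows "con k S = con k S'"
proof -
  define \<theta> \<theta>' where "\<theta> = con k S" and "\<theta>' = con k S'"
  have \<theta>: "term_congruence ar k \<theta>" "term_congruence ar k \<theta>'"
    unfolding \<theta>_def \<theta>'_def by (intro term_congruence_con S)+
  have "isomorphic ar (quotient_terms ar k \<theta>') (quotient_terms ar k \<theta>)"
    using isomorphic_presented_sym [OF S(1) iso] by (simp add: presented_eq \<theta>_def \<theta>'_def)
  \<comment> \<open>Preceded by the projection modulo \<theta>', the isomorphism becomes a
    surjective endomorphism of the quotient by \<theta> with kernel \<theta>'.\<close>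
  then obtain \<sigma> where \<sigma>: "\<And>i. i < k \<Longrightarrow> \<sigma> i \<in> T k" and eq: "\<theta>' = pullback ar k \<sigma> \<theta>"
    and surj: "\<And>t. t \<in> T k \<Longrightarrow> \<exists>s\<in>T k. (subst \<sigma> s, t) \<in> \<theta>"
    unfolding isomorphic_quotient_terms_iff [OF \<theta>(2,1)] induces_iso_def by blast
  have in_terms: "subst \<sigma> t \<in> T k" if "t \<in> T k" for t
    by (rule subst_in_terms [OF that]) (simp add: \<sigma>)
  have "\<theta> \<subseteq> \<theta>'"
    using sub by (simp add: \<theta>_def \<theta>'_def)
  then have step: "(subst \<sigma> s, subst \<sigma> t) \<in> \<theta>" if "(s, t) \<in> \<theta>" for s t
    using that eq by (auto simp: pullback_def)
  \<comment> \<open>\<open>\<psi> i\<close> is the kernel of the i-th power of this endomorphism; in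
    particular \<open>\<psi> 0\<close> is \<theta> and \<open>\<psi> 1\<close> is \<theta>'.\<close>
  define \<psi> where "\<psi> i = ((\<lambda>\<theta>. pullback ar k \<sigma> \<theta>) ^^ i) \<theta>" for i
  have \<psi>_Suc: "\<psi> (Suc i) = pullback ar k \<sigma> (\<psi> i)" for i
    by (simp add: \<psi>_def)
  have \<psi>: "term_congruence ar k (\<psi> i)" for i
  proof (induction i)
    case 0
    then show ?case
      by (simp add: \<psi>_def \<theta>)
  next
    case (Suc i)
    then show ?case
      unfolding \<psi>_Suc by (rule term_congruence_pullback) (rule \<sigma>)
  qed
  have mono: "\<psi> i \<subseteq> \<psi> (Suc i)" for i
  proof (induction i)
    case 0
    show ?case
      using \<open>\<theta> \<subseteq> \<theta>'\<close> by (simp add: \<psi>_def eq)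
  next
    case (Suc i)
    then show ?case
      unfolding \<psi>_Suc pullback_def by blast
  qed
  have "con k {} \<subseteq> \<psi> 0"
    by (simp add: \<psi>_def \<theta>_def presented_congruence_mono)
  from term_congruence_chain [OF k \<psi> this mono] obtain N where N: "\<And>i. i \<ge> N \<Longrightarrow> \<psi> i = \<psi> N"
    by blast
  have \<theta>_sub: "\<theta> \<subseteq> \<psi> i" for i
  proof (induction i)
    case (Suc i)
    then show ?case
      using mono [of i] by blast
  qed (simp add: \<psi>_def)
  \<comment> \<open>Surjectivity allows one application of the endomorphism to be cancelled: s and t
    are replaced by preimages, for which the assumed inclusion is available one level up.\<close>
  have surj': "(s, t) \<in> \<psi> i" if "(s, t) \<in> \<psi> (Suc i)" "\<psi> (Suc (Suc i)) \<subseteq> \<psi> (Suc i)" for i s t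
  proof -
    have st: "s \<in> T k" "t \<in> T k"
      using that(1) term_congruence_subset [OF \<psi>] by blast+
    then obtain s' t' where st': "s' \<in> T k" "t' \<in> T k" "(subst \<sigma> s', s) \<in> \<theta>" "(subst \<sigma> t', t) \<in> \<theta>"
      using surj by blast
    then have "(subst \<sigma> s', subst \<sigma> t') \<in> \<psi> (Suc i)"
      using that(1) \<theta>_sub term_congruence_trans [OF \<psi>] term_congruence_sym [OF \<psi>] by (meson subsetD)
    then have "(s', t') \<in> \<psi> (Suc (Suc i))"
      unfolding \<psi>_Suc [of "Suc i"] using st' by (simp add: pullback_def)
    then have "(s', t') \<in> \<psi> (Suc i)"
      using that(2) by blast
    then have "(subst \<sigma> s', subst \<sigma> t') \<in> \<psi> i"
      unfolding \<psi>_Suc [of i] by (simp add: pullback_def)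
    then show ?thesis
      using st' \<theta>_sub term_congruence_trans [OF \<psi>] term_congruence_sym [OF \<psi>] by (meson subsetD)
  qed
  have descend: "\<psi> (Suc i) \<subseteq> \<psi> i" if "\<psi> (Suc (Suc i)) \<subseteq> \<psi> (Suc i)" for i
    using surj' [OF _ that] by auto
  have "\<psi> (Suc N) \<subseteq> \<psi> N"
    using N [of "Suc N"] by simp
  \<comment> \<open>Stability is carried down from N to 0 one level at a time. Truncated subtraction
    makes the induction harmless once 0 is reached.\<close>
  then have "\<psi> (Suc (N - j)) \<subseteq> \<psi> (N - j)" for j
  proof (induction j)
    case (Suc j)
    show ?case
    proof (cases "N - j = 0")
      case False
      then have "N - j = Suc (N - Suc j)"
        by simp
      then show ?thesis
        using descend [of "N - Suc j"] Suc by simp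
    qed (use Suc in simp)
  qed simp
  from this [of N] have "\<psi> 1 \<subseteq> \<psi> 0"
    by simp
  then have "\<theta>' \<subseteq> \<theta>"
    by (simp add: \<psi>_def eq)
  then show ?thesis
    using sub by (simp add: \<theta>_def \<theta>'_def)
qed

text \<open>The congruences of the stages form an ascending chain, and its stable value contains the
  relations of every stage. Thus a late stage already presents the limit algebra.\<close>

lemma con_eventually_constant:
  fixes A :: "nat \<Rightarrow> nat set"
  assumes k: "k \<ge> 1" and "mono A"
  obtains N where "\<And>s. s \<ge> N \<Longrightarrow> con k (pair_of ar k ` A s) = con k (pair_of ar k ` (\<Union>s. A s))"
proof -
  let ?C = "\<lambda>s. con k (pair_of ar k ` A s)"
  have S: "pair_of ar k ` A s \<subseteq> T k \<times> T k" for s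
    by (rule pair_of_terms [OF k])
  have mono: "?C s \<subseteq> ?C t" if "s \<le> t" for s t
    using monoD [OF \<open>mono A\<close> that] by (intro presented_congruence_mono image_mono)
  have "con k {} \<subseteq> ?C 0"
    by (rule presented_congruence_mono) simp
  from term_congruence_chain [of k ?C, OF k term_congruence_con [OF S] this mono]
  obtain N where N: "\<And>s. s \<ge> N \<Longrightarrow> ?C s = ?C N"
    by auto
  have "con k (pair_of ar k ` (\<Union>s. A s)) \<subseteq> ?C N"
  proof (rule presented_congruence_least [OF term_congruence_con [OF S] _ law_instances_subset])
    have "pair_of ar k ` A s \<subseteq> ?C N" for s
      using subset_presented_congruence [of "pair_of ar k ` A s" ar L k]
        mono [of s "max s N"] N [of "max s N"] by auto
    then show "pair_of ar k ` (\<Union>s. A s) \<subseteq> ?C N"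
      by blast
  qed
  moreover have "?C N \<subseteq> con k (pair_of ar k ` (\<Union>s. A s))"
    by (intro presented_congruence_mono image_mono) blast
  ultimately have "?C s = con k (pair_of ar k ` (\<Union>s. A s))" if "s \<ge> N" for s
    using N [OF that] by simp
  then show thesis
    using that by blast
qed

end


section \<open>Comparison of consecutive numbers of generators\<close>

context laws
begin

lemma lift_mono: "A \<subseteq> B \<Longrightarrow> lift n A \<subseteq> lift n B"
  unfolding lift_def by blast

text \<open>Membership in a lift depends on at most one element of the lifted set, so lifting
  commutes with the union of the stages.\<close>

lemma lift_Union_stage: "lift n (W e) = {c. \<exists>s. c \<in> lift n (stage e s)}"
  unfolding lift_def Union_stage [symmetric] by blast

text \<open>Elements of a stage are below its number, which bounds the search for c'. The comparison
  is between codes over n variables, after applying the collapse computably.\<close>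

lemma decidable_lift_stage:
  assumes n: "n \<ge> 1" and comp: "computable c" "computable e" "computable s"
  shows "decidable (\<lambda>z. c z \<in> lift n (stage (e z) (s z)))"
proof -
  obtain r where r: "computable r"
    "\<And>c. term_of ar n (r c) = subst (\<lambda>i. Var (if i = n then 0 else i)) (term_of ar (n + 1) c)"
  proof (rule term_of_rename_variables [of "n + 1" n "\<lambda>i. if i = n then 0 else i" ar])
    show "computable (\<lambda>i. if i = n then 0 else i)"
      by (intro computable_intros)
  qed (use n in \<open>auto split: if_splits\<close>)
  have collapse: "collapse n = (\<lambda>i. Var (if i = n then 0 else i))"
    by (simp add: collapse_def fun_eq_iff)
  have lt: "c' \<in> stage e s \<Longrightarrow> c' < s" for c' e s
    by (simp add: stage_def)
  have "pair_of ar n c' = map_prod (subst (collapse n)) (subst (collapse n)) (pair_of ar (n + 1) c) \<longleftrightarrow>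
      term_of ar n (pfst c') = term_of ar n (r (pfst c)) \<and>
      term_of ar n (psnd c') = term_of ar n (r (psnd c))" for c c'
    by (simp only: pair_of_def collapse r map_prod_def case_prod_unfold prod.inject fst_conv snd_conv)
  then have iff: "c \<in> lift n (stage e s) \<longleftrightarrow> c = prod_encode (n, 0) \<or>
      (\<exists>c'<s. c' \<in> stage e s \<and> term_of ar n (pfst c') = term_of ar n (r (pfst c)) \<and>
        term_of ar n (psnd c') = term_of ar n (r (psnd c)))" for c e s
    unfolding lift_def using lt by auto
  show ?thesis
    unfolding iff
    by (intro computable_intros decidable_stage decidable_term_of_eq [OF n]
        computable_compose [OF r(1)] comp comp [THEN computable_compose])
qed

lemma iso_relation_reducible_Suc:
  assumes n: "n \<ge> 1"
  shows "iso_relation ar L n \<le>\<^sub>c iso_relation ar L (n + 1)"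
proof -
  have "decidable (\<lambda>z. psnd (pfst z) \<in> lift n (stage (pfst (pfst z)) (psnd z)))"
    by (intro decidable_lift_stage n computable_intros)
  from parametrized_index [of "\<lambda>e c s. c \<in> lift n (stage e s)", OF this]
  obtain h where "computable h" "\<And>e. W (h e) = lift n (W e)"
    unfolding lift_Union_stage by blast
  then show ?thesis
    unfolding reducible_def iso_relation_def indexed_algebra_def
    using isomorphic_lift_iff [OF n] by auto
qed

end

section \<open>The diagonal argument\<close>

context noetherian_laws
begin

text \<open>
  \<open>A\<close> and \<open>B\<close> are the stages of the presentations to which a reduction maps the presentations
  \<open>Wa\<close> and \<open>Wb\<close>.  The latter are chosen to disagree with what the former show.
\<close>

lemma no_diagonal_presentations:
  fixes A B :: "nat \<Rightarrow> nat set"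
  assumes n: "n \<ge> 1" and nontriv: "nontrivial ar L" and A: "mono A" and B: "mono B"
  defines "P \<equiv> \<lambda>S. presented ar L n (pair_of ar n ` S)"
    and "P' \<equiv> \<lambda>S. presented ar L (n + 1) (pair_of ar (n + 1) ` S)"
  defines "I \<equiv> \<lambda>s. isomorphic ar (P (A s)) (P (B s))"
  defines "Wa \<equiv> {c. \<exists>s. I s \<and> c \<in> lift n (A s)}"
    and "Wb \<equiv> {c. \<exists>s. I s \<and> (\<exists>s'>s. \<not> I s') \<and> c \<in> lift n (A s)}"
  assumes iff: "isomorphic ar (P' Wa) (P' Wb) \<longleftrightarrow>
    isomorphic ar (P (\<Union>s. A s)) (P (\<Union>s. B s))"
  shows False
proof -
  let ?C = "\<lambda>S. con n (pair_of ar n ` S)"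
  let ?C' = "\<lambda>S. con (n + 1) (pair_of ar (n + 1) ` S)"
  let ?A = "\<Union>s. A s" and ?B = "\<Union>s. B s"
  have n1: "n + 1 \<ge> 1"
    by simp
  have mono: "?C S \<subseteq> ?C S'" if "S \<subseteq> S'" for S S'
    using that by (intro presented_congruence_mono image_mono)
  have P_eq: "P S = P S'" if "?C S = ?C S'" for S S'
    using that by (simp add: P_def presented_eq)
  have P_sym: "isomorphic ar X (P S)" if "isomorphic ar (P S) X" for S and X :: "trm set algebra"
    using isomorphic_presented_sym [OF pair_of_terms [OF n] that [unfolded P_def]] by (simp add: P_def)
  have P'_sym: "isomorphic ar X (P' S)" if "isomorphic ar (P' S) X" for S and X :: "trm set algebra"
    using isomorphic_presented_sym [OF pair_of_terms [OF n1] that [unfolded P'_def]] by (simp add: P'_def)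
  have hopf: "?C S = ?C S'" if "S \<subseteq> S'" "isomorphic ar (P S) (P S')" for S S'
    using hopfian [OF n pair_of_terms [OF n] pair_of_terms [OF n] mono [OF that(1)]] that(2)
    by (simp add: P_def)
  have A_sub: "A s \<subseteq> A t" and B_sub: "B s \<subseteq> B t" if "s \<le> t" for s t
    using that monoD [OF A] monoD [OF B] by auto
  obtain Na where Na: "\<And>s. s \<ge> Na \<Longrightarrow> ?C (A s) = ?C ?A"
    using con_eventually_constant [OF n A] by blast
  obtain Nb where Nb: "\<And>s. s \<ge> Nb \<Longrightarrow> ?C (B s) = ?C ?B"
    using con_eventually_constant [OF n B] by blast
  define N where "N = max Na Nb"
  have I_eq: "I s \<longleftrightarrow> isomorphic ar (P ?A) (P ?B)" if "?C (A s) = ?C ?A" "?C (B s) = ?C ?B" for s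
    using that [THEN P_eq] by (simp add: I_def)
  have I_N: "I s \<longleftrightarrow> isomorphic ar (P ?A) (P ?B)" if "s \<ge> N" for s
    using that Na Nb by (intro I_eq) (simp_all add: N_def)
  show False
  proof (cases "isomorphic ar (P ?A) (P ?B)")
    case False
    \<comment> \<open>Non-isomorphic stages keep appearing, so the extra condition in
      \<open>Wb\<close> always holds.\<close>
    have "\<exists>s'>s. \<not> I s'" for s
      using False I_N [of "max N (Suc s)"] by (intro exI [of _ "max N (Suc s)"]) auto
    then have "Wa = Wb"
      by (simp add: Wa_def Wb_def)
    then show False
      using False iff by (simp add: isomorphic_refl)
  next
    case True
    have "Wa = lift n ?A"
    proof
      show "Wa \<subseteq> lift n ?A"
        using lift_mono [of "A _" ?A n] unfolding Wa_def by blast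
      show "lift n ?A \<subseteq> Wa"
      proof
        fix c
        assume "c \<in> lift n ?A"
        then obtain s where "c \<in> lift n (A s)"
          unfolding lift_def by blast
        then have "c \<in> lift n (A (max s N))"
          using lift_mono A_sub by (meson max.cobounded1 subsetD)
        then show "c \<in> Wa"
          using I_N [of "max s N"] True unfolding Wa_def by auto
      qed
    qed
    then have iso: "isomorphic ar (P' Wb) (P' (lift n ?A))"
      using iff True P'_sym by simp
    \<comment> \<open>Z consists of the stages that contribute to \<open>Wb\<close>. From stage N on
      all stages are isomorphic, so Z is finite.\<close>
    define Z where "Z = {s. I s \<and> (\<exists>s'>s. \<not> I s')}"
    have Wb: "Wb = {c. \<exists>s\<in>Z. c \<in> lift n (A s)}"
      by (auto simp: Wb_def Z_def)
    show False
    proof (cases "Z = {}")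
      case empty: True
      have "?C' {} = ?C' (lift n ?A)"
      proof (rule hopfian [OF n1 pair_of_terms [OF n1] pair_of_terms [OF n1]])
        show "?C' {} \<subseteq> ?C' (lift n ?A)"
          by (rule presented_congruence_mono) simp
      qed (use iso in \<open>simp add: P'_def Wb empty\<close>)
      moreover have "(Var n, Var 0) \<in> ?C' (lift n ?A)"
      proof -
        have "prod_encode (n, 0) \<in> lift n ?A"
          by (simp add: lift_def)
        then show ?thesis
          using subset_presented_congruence pair_of_generators by (metis image_eqI subsetD)
      qed
      ultimately show False
        using trivial_if_generators_identified [OF n] nontriv by simp
    next
      case nonempty: False
      have "Z \<subseteq> {..<N}"
      proof
        fix s
        assume "s \<in> Z"
        then obtain s' where "s' > s" "\<not> I s'"
          unfolding Z_def by blast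
        then show "s \<in> {..<N}"
          using I_N [of s'] True by fastforce
      qed
      then have "finite Z"
        by (rule finite_subset) simp
      \<comment> \<open>Lifts of stages increase, so the last contributing stage alone determines
        \<open>Wb\<close>.\<close>
      define m where "m = Max Z"
      have m: "m \<in> Z" "\<And>s. s \<in> Z \<Longrightarrow> s \<le> m"
        using \<open>finite Z\<close> nonempty by (simp_all add: m_def)
      have "Wb = lift n (A m)"
        unfolding Wb using m lift_mono A_sub by blast
      then have "isomorphic ar (P (A m)) (P ?A)"
        using iso isomorphic_lift_iff [OF n] by (simp add: P_def P'_def)
      then have CA: "?C (A m) = ?C ?A"
        by (intro hopf) blast
      have "isomorphic ar (P (A m)) (P (B m))"
        using m(1) by (simp add: Z_def I_def)
      then have "isomorphic ar (P (B m)) (P ?B)"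
        using isomorphic_trans [OF P_sym True] P_eq [OF CA] by metis
      then have CB: "?C (B m) = ?C ?B"
        by (intro hopf) blast
      \<comment> \<open>Both congruences have reached their limits at m and are squeezed between
        equal ones afterwards. So no later stage can refute isomorphism, contrary to m being in
        Z.\<close>
      have "I s" if "s > m" for s
      proof -
        have "?C (A s) = ?C ?A"
          using mono [of "A m" "A s"] mono [of "A s" ?A] A_sub [of m s] that CA by auto
        moreover have "?C (B s) = ?C ?B"
          using mono [of "B m" "B s"] mono [of "B s" ?B] B_sub [of m s] that CB by auto
        ultimately show ?thesis
          using I_eq True by blast
      qed
      then show False
        using m(1) by (auto simp: Z_def)
    qed
  qed
qed

text \<open>Stages are finite, so the isomorphism algorithm decides whether two of them present
  isomorphic algebras. This makes the diagonal presentations c.e. in their own index, as the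
  recursion theorem requires.\<close>

lemma iso_relation_Suc_not_reducible:
  assumes n: "n \<ge> 1" and nontriv: "nontrivial ar L" and dec: "finite_iso_decidable ar L"
  shows "\<not> iso_relation ar L (n + 1) \<le>\<^sub>c iso_relation ar L n"
proof
  assume "iso_relation ar L (n + 1) \<le>\<^sub>c iso_relation ar L n"
  then obtain h where h: "computable h"
    and red: "\<And>x y. iso_relation ar L (n + 1) x y \<longleftrightarrow> iso_relation ar L n (h x) (h y)"
    unfolding reducible_def by blast
  obtain d where d: "computable d" and d_eq: "\<And>u v.
      d (prod_encode (n, prod_encode (n, prod_encode (u, v)))) =
        (if isomorphic ar (presented ar L n (pair_of ar n ` set_decode u))
          (presented ar L n (pair_of ar n ` set_decode v)) then 1 else 0)"
    using dec n unfolding finite_iso_decidable_def by blast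
  define A where "A e i = stage (h (curry_index e i))" for e i
  define I where "I e s \<longleftrightarrow> isomorphic ar (presented ar L n (pair_of ar n ` A e 0 s))
    (presented ar L n (pair_of ar n ` A e 1 s))" for e s
  have I_eq: "I e s \<longleftrightarrow> d (prod_encode (n, prod_encode (n, prod_encode
      (set_encode (stage (h (curry_index e 0)) s), set_encode (stage (h (curry_index e 1)) s))))) = 1"
    for e s
    by (simp add: d_eq I_def A_def set_encode_inverse finite_stage)
  have decidable_I: "decidable (\<lambda>z. I (e z) (s z))" if "computable e" "computable s" for e s
    unfolding I_eq
    by (intro computable_intros computable_compose [OF d] computable_compose [OF h]
        computable_stage computable_curry_index that)
  \<comment> \<open>The witness t codes a stage and a later one. Parameter 0 gives the first
    diagonal set, which ignores the later stage; any other parameter gives the second.\<close>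
  define P where "P e i c t \<longleftrightarrow> I e (pfst t) \<and> c \<in> lift n (A e 0 (pfst t)) \<and>
    (i = 0 \<or> pfst t < psnd t \<and> \<not> I e (psnd t))" for e i c t :: nat
  have "decidable (\<lambda>z. P (pfst (pfst z)) (pfst (psnd (pfst z))) (psnd (psnd (pfst z))) (psnd z))"
    unfolding P_def A_def
    by (intro computable_intros decidable_I decidable_lift_stage n computable_compose [OF h]
        computable_curry_index)
  from recursion_theorem_index [of P, OF this]
  obtain e where e: "\<And>i. W (curry_index e i) = {c. \<exists>t. P e i c t}"
    by blast
  have ex_pair: "(\<exists>t. Q (pfst t) (psnd t)) \<longleftrightarrow> (\<exists>s s'. Q s s')" for Q :: "nat \<Rightarrow> nat \<Rightarrow> bool"
    by (metis fst_conv snd_conv prod_encode_inverse)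
  have "W (curry_index e 0) = {c. \<exists>s. I e s \<and> c \<in> lift n (A e 0 s)}"
    unfolding e P_def
    using ex_pair [of "\<lambda>s s'. I e s \<and> c \<in> lift n (A e 0 s)" for c] by simp
  moreover have "W (curry_index e 1) = {c. \<exists>s. I e s \<and> (\<exists>s'>s. \<not> I e s') \<and> c \<in> lift n (A e 0 s)}"
    unfolding e P_def using ex_pair [of "\<lambda>s s'. I e s \<and> c \<in> lift n (A e 0 s) \<and>
      s < s' \<and> \<not> I e s'" for c] by (simp, intro Collect_cong) blast
  moreover have "(\<Union>s. A e i s) = W (h (curry_index e i))" for i
    unfolding A_def by (rule Union_stage)
  moreover have "mono (A e i)" for i
    unfolding A_def by (rule mono_stage)
  ultimately show False
    using no_diagonal_presentations [OF n nontriv, of "A e 0" "A e 1"]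
      red [of "curry_index e 0" "curry_index e 1"]
    unfolding iso_relation_def indexed_algebra_def I_def by simp
qed

end

theorem theorem4p15:
  fixes ar :: "nat list" and L :: "(trm \<times> trm) set"
  assumes "ce_laws ar L"
    and "nontrivial ar L"
    and "ascending_chain_condition ar L"
    and "finite_iso_decidable ar L"
  shows "\<forall>n\<ge>1. iso_relation ar L n <\<^sub>c iso_relation ar L (n + 1)"
proof -
  interpret noetherian_laws ar L
    using assms(1,3) by unfold_locales (simp_all add: ce_laws_def)
  show ?thesis
    unfolding strictly_reducible_def
    using iso_relation_reducible_Suc iso_relation_Suc_not_reducible assms(2,4) by blast
qed

end
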